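(* Let $p\in(1,\infty)$, $q\in(1,p]$, $r\in[1,q)$, and let $v$ be a weight on $\mathbf{R}^d$ with $v^p\in A_{p(\frac1r-\frac1q)+1}$. Then \[ M_r:\mathcal{B}^{p,q}_v(\mathbf{R}^d)\to\mathcal{B}^{p,q}_v(\mathbf{R}^d) \] is bounded.
   Context: A weight is a measurable function with $0<v<\infty$ a.e. on $\mathbf{R}^d$. $Q$ denotes cubes with sides parallel to the axes, $\langle f\rangle_{p,Q}=\big(\frac1{|Q|}\int_Q|f|^p\big)^{1/p}$, and $M_rf=\sup_Q\langle f\rangle_{r,Q}\mathbf{1}_Q$. $A_t$ ($1<t<\infty$) is the classical Muckenhoupt class: $u\in A_t$ iff $\sup_Q\big(\frac1{|Q|}\int_Qu\big)\big(\frac1{|Q|}\int_Qu^{-\frac1{t-1}}\big)^{t-1}<\infty$. A measurable function $b$ is a $(p,q)$-block if there is a cube $Q$ with $\operatorname{supp}b\subseteq Q$ and $|Q|^{1/q}\langle b\rangle_{p,Q}\le1$. The block space $\mathcal{B}^{p,q}(\mathbf{R}^d)$ consists of those $f$ that can be written as $f=\sum_{n\in\mathbf{N}}\lambda_nb_n$ with $(\lambda_n)\in\ell^1(\mathbf{N})$ and $(p,q)$-blocks $b_n$, with norm $\inf\|(\lambda_n)\|_{\ell^1}$ over all such representations. $\mathcal{B}^{p,q}_v(\mathbf{R}^d)$ is the space of $f$ with $fv\in\mathcal{B}^{p,q}(\mathbf{R}^d)$, $\|f\|_{\mathcal{B}^{p,q}_v}=\|fv\|_{\mathcal{B}^{p,q}}$.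 *)

theory Defs
  imports "HOL-Analysis.Analysis"
begin

text \<open>
  Functions are complex-valued and Lebesgue measurable, and identified when they agree almost
  everywhere. Averages and maximal functions are computed in \<^typ>\<open>ennreal\<close>, so that they make
  sense, possibly with value \<open>\<infinity>\<close>, without integrability assumptions.
\<close>

definition cubes :: "'a::euclidean_space set set" where
  "cubes = {cbox a (a + l *\<^sub>R One) | a l. 0 < l}"

text \<open>Only used with exponent \<open>s > 0\<close>.\<close>

definition ennpowr :: "ennreal \<Rightarrow> real \<Rightarrow> ennreal" where
  "ennpowr x s = (if x = \<infinity> then \<infinity> else ennreal (enn2real x powr s))"

definition mean :: "'a::euclidean_space set \<Rightarrow> ('a \<Rightarrow> ennreal) \<Rightarrow> ennreal" where
  "mean Q g = (\<integral>\<^sup>+ x\<in>Q. g x \<partial>lebesgue) / emeasure lebesgue Q"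

definition p_mean :: "real \<Rightarrow> 'a::euclidean_space set \<Rightarrow> ('a \<Rightarrow> complex) \<Rightarrow> ennreal" where
  "p_mean p Q f = ennpowr (mean Q (\<lambda>x. ennreal (norm (f x) powr p))) (1 / p)"

definition maximal :: "real \<Rightarrow> ('a::euclidean_space \<Rightarrow> complex) \<Rightarrow> 'a \<Rightarrow> ennreal" where
  "maximal r f x = (SUP Q\<in>cubes. p_mean r Q f * indicator Q x)"

definition weight :: "('a::euclidean_space \<Rightarrow> real) \<Rightarrow> bool" where
  "weight v \<longleftrightarrow> v \<in> borel_measurable lebesgue \<and> (AE x in lebesgue. 0 < v x)"

definition muckenhoupt :: "real \<Rightarrow> ('a::euclidean_space \<Rightarrow> real) set" where
  "muckenhoupt t = {u. weight u \<and>
     (SUP Q\<in>cubes. mean Q (\<lambda>x. ennreal (u x)) *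
        ennpowr (mean Q (\<lambda>x. ennreal (u x powr (- (1 / (t - 1)))))) (t - 1)) < \<infinity>}"

definition is_block :: "real \<Rightarrow> real \<Rightarrow> ('a::euclidean_space \<Rightarrow> complex) \<Rightarrow> bool" where
  "is_block p q b \<longleftrightarrow> b \<in> borel_measurable lebesgue \<and>
     (\<exists>Q\<in>cubes. (AE x in lebesgue. x \<notin> Q \<longrightarrow> b x = 0) \<and>
        ennpowr (emeasure lebesgue Q) (1 / q) * p_mean p Q b \<le> 1)"

text \<open>
  The series is required to converge pointwise almost everywhere. For \<open>1 < q \<le> p\<close> every
  \<open>(p,q)\<close>-block has \<open>L\<^sup>q\<close>-norm at most 1, so the series converges absolutely almost everywhere and in
  \<open>L\<^sup>q\<close> as soon as the coefficients are summable, and every sensible mode of convergence gives the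
  same sum.
\<close>

definition block_representation ::
  "real \<Rightarrow> real \<Rightarrow> ('a::euclidean_space \<Rightarrow> complex) \<Rightarrow> (nat \<Rightarrow> complex) \<Rightarrow>
    (nat \<Rightarrow> 'a \<Rightarrow> complex) \<Rightarrow> bool" where
  "block_representation p q f c b \<longleftrightarrow>
     summable (\<lambda>n. norm (c n)) \<and> (\<forall>n. is_block p q (b n)) \<and>
     (AE x in lebesgue. (\<lambda>n. c n * b n x) sums f x)"

definition block_space :: "real \<Rightarrow> real \<Rightarrow> ('a::euclidean_space \<Rightarrow> complex) set" where
  "block_space p q = {f. \<exists>c b. block_representation p q f c b}"

definition block_norm :: "real \<Rightarrow> real \<Rightarrow> ('a::euclidean_space \<Rightarrow> complex) \<Rightarrow> real" where
  "block_norm p q f = Inf {(\<Sum>n. norm (c n)) | c b. block_representation p q f c b}"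

definition weighted_block_space ::
  "real \<Rightarrow> real \<Rightarrow> ('a::euclidean_space \<Rightarrow> real) \<Rightarrow> ('a \<Rightarrow> complex) set" where
  "weighted_block_space p q v = {f. (\<lambda>x. f x * of_real (v x)) \<in> block_space p q}"

definition weighted_block_norm ::
  "real \<Rightarrow> real \<Rightarrow> ('a::euclidean_space \<Rightarrow> real) \<Rightarrow> ('a \<Rightarrow> complex) \<Rightarrow> real" where
  "weighted_block_norm p q v f = block_norm p q (\<lambda>x. f x * of_real (v x))"

text \<open>
  Boundedness of an operator \<open>T\<close> whose values are \<open>[0,\<infinity>]\<close>-valued functions: \<open>T f\<close> belongs to the
  space only if it is finite almost everywhere, in which case it is converted to a complex-valued
  function.
\<close>

definition bounded_on_weighted_block_space ::
  "real \<Rightarrow> real \<Rightarrow> ('a::euclidean_space \<Rightarrow> real) \<Rightarrow>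
    (('a \<Rightarrow> complex) \<Rightarrow> 'a \<Rightarrow> ennreal) \<Rightarrow> bool" where
  "bounded_on_weighted_block_space p q v T \<longleftrightarrow>
     (\<exists>C\<ge>0. \<forall>f\<in>weighted_block_space p q v.
        (AE x in lebesgue. T f x < \<infinity>) \<and>
        (\<lambda>x. of_real (enn2real (T f x))) \<in> weighted_block_space p q v \<and>
        weighted_block_norm p q v (\<lambda>x. of_real (enn2real (T f x)))
          \<le> C * weighted_block_norm p q v f)"

end

theory Submission
  imports Defs
begin

text \<open>
  Let \<open>f v = \<Sum>\<^sub>n c\<^sub>n b\<^sub>n\<close> be a representation by blocks. By Minkowski's inequality \<open>M\<^sub>r\<close> is countably subadditive,
  so \<open>v M\<^sub>r f\<close> is at most \<open>\<Sum>\<^sub>n \<bar>c\<^sub>n\<bar> v M\<^sub>r(b\<^sub>n/v)\<close> (\<open>maximal_suminf_le\<close>). The block space is an ideal: a measurable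
  function below a series of nonnegative blocks with summable coefficients has a block representation with
  the same coefficients (\<open>block_representation_of_majorant\<close>). Hence it suffices to majorize \<open>v M\<^sub>r(b/v)\<close>, for a
  single block \<open>b\<close> on a cube \<open>Q\<close>, by a series of blocks whose coefficients have a bounded sum.

  The space is cut into \<open>3Q\<close> and the annuli \<open>3\<^sup>k\<^sup>+\<^sup>1Q - 3\<^sup>kQ\<close>, and \<open>v M\<^sub>r(b/v)\<close> restricted to the \<open>k\<close>-th piece
  turns out to be \<open>K \<eta>\<^sup>k\<close> times a block, with \<open>\<eta> < 1\<close> (\<open>annulus_bounds\<close>). Put \<open>w = v\<^sup>p\<close>, \<open>\<tau> = p (1/r - 1/q)\<close> and
  \<open>\<sigma> = w\<^sup>-\<^sup>1\<^sup>/\<^sup>\<tau>\<close>, so that the hypothesis reads \<open>w \<in> A\<^sub>1\<^sub>+\<^sub>\<tau>\<close>.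

  On \<open>3Q\<close> it is enough that \<open>M\<^sub>r\<close> is bounded on \<open>L\<^sup>p(w)\<close>. This is Muckenhoupt's theorem for \<open>A\<^sub>p\<^sub>/\<^sub>r\<close>, a class that
  contains \<open>A\<^sub>1\<^sub>+\<^sub>\<tau>\<close> because \<open>q \<le> p\<close>. The proof is Lerner's: the maximal function is bounded pointwise by the
  composition of the maximal operators for the measures \<open>w\<close> and \<open>\<sigma>\<close> (\<open>maxop_le_weighted_maxop\<close>). Both
  measures are doubling, so the Vitali covering argument and interpolation apply to them
  (\<open>maxop_strong_type\<close>).

  Away from \<open>3Q\<close> only cubes comparable to \<open>3\<^sup>k\<^sup>+\<^sup>1Q\<close> or larger see the block, so \<open>M\<^sub>r(b/v)\<^sup>r\<close> is there at
  most a constant times the integral of \<open>\<bar>b/v\<bar>\<^sup>r\<close> divided by the volume of \<open>3\<^sup>k\<^sup>+\<^sup>1Q\<close>. Holder's inequality bounds this integral through \<open>\<sigma>(Q)\<close>, and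
  the \<open>A\<^sub>1\<^sub>+\<^sub>\<tau>\<close> condition on \<open>3\<^sup>k\<^sup>+\<^sup>1Q\<close>, with precisely the exponents of the hypothesis, yields a bound that is
  uniform in \<open>k\<close>. The decay needed for summation comes from \<open>\<sigma>(Q) \<le> \<theta>\<^sup>k \<sigma>(3\<^sup>kQ)\<close> with \<open>\<theta> < 1\<close>, a consequence of
  doubling alone (\<open>wt_reverse_doubling\<close>).
\<close>

section \<open>Powers of extended nonnegative reals\<close>

lemma ennpowr_ennreal: "0 \<le> x \<Longrightarrow> ennpowr (ennreal x) s = ennreal (x powr s)"
  by (simp add: ennpowr_def)

lemma ennpowr_0 [simp]: "ennpowr 0 s = 0"
  by (simp add: ennpowr_def)

lemma ennpowr_top [simp]: "ennpowr top s = top"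
  by (simp add: ennpowr_def)

lemma ennpowr_one [simp]: "ennpowr 1 s = 1"
  by (simp add: ennpowr_def)

lemma ennpowr_1 [simp]: "ennpowr x 1 = x"
  by (cases x) (simp_all add: ennpowr_ennreal)

lemma ennpowr_eq_0_iff [simp]: "ennpowr x s = 0 \<longleftrightarrow> x = 0"
  by (cases x) (auto simp: ennpowr_ennreal)

lemma ennpowr_eq_top_iff [simp]: "ennpowr x s = top \<longleftrightarrow> x = top"
  by (cases x) (auto simp: ennpowr_ennreal)

lemma ennpowr_less_top_iff [simp]: "ennpowr x s < top \<longleftrightarrow> x < top"
  by (simp add: less_top[symmetric])

lemma ennpowr_mono: "x \<le> y \<Longrightarrow> 0 \<le> s \<Longrightarrow> ennpowr x s \<le> ennpowr y s"
  by (cases x; cases y) (auto simp: ennpowr_ennreal powr_mono2 top_unique)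

lemma ennpowr_mult: "ennpowr (x * y) s = ennpowr x s * ennpowr y s"
  by (cases x; cases y)
    (auto simp: ennpowr_ennreal powr_mult ennreal_mult[symmetric] ennreal_mult_top ennreal_top_mult)

lemma ennpowr_ennpowr: "ennpowr (ennpowr x s) t = ennpowr x (s * t)"
  by (cases x) (auto simp: ennpowr_ennreal powr_powr)

lemma ennpowr_add: "ennpowr x s * ennpowr x t = ennpowr x (s + t)"
  by (cases x) (auto simp: ennpowr_ennreal powr_add ennreal_mult[symmetric])

lemma ennpowr_divide:
  assumes "y \<noteq> 0" "y \<noteq> top"
  shows "ennpowr (x / y) s = ennpowr x s / ennpowr y s"
proof -
  from assms obtain b where b: "y = ennreal b" "0 < b"
    by (cases y) (auto simp: ennreal_eq_0_iff not_le)
  show ?thesis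
    by (cases x) (use b in \<open>auto simp: ennpowr_ennreal divide_ennreal powr_divide
          ennreal_top_divide\<close>)
qed

lemma measurable_ennpowr [measurable]:
  assumes [measurable]: "f \<in> borel_measurable M"
  shows "(\<lambda>x. ennpowr (f x) s) \<in> borel_measurable M"
  unfolding ennpowr_def by measurable

section \<open>Integral inequalities\<close>

lemma ennpowr_weighted_arith_geo:
  assumes "0 < \<alpha>" "\<alpha> < 1"
  shows "ennpowr a \<alpha> * ennpowr b (1 - \<alpha>) \<le> ennreal \<alpha> * a + ennreal (1 - \<alpha>) * b"
proof (cases "a = 0 \<or> b = 0 \<or> a = top \<or> b = top")
  case True
  then show ?thesis
    using assms by (auto simp: ennreal_mult_top ennreal_top_mult ennreal_eq_0_iff)
next
  case False
  then obtain x y where xy: "a = ennreal x" "b = ennreal y" "0 < x" "0 < y"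
    by (cases a; cases b) (auto simp: ennreal_eq_0_iff not_le)
  have "x powr \<alpha> * y powr (1 - \<alpha>) \<le> \<alpha> * x + (1 - \<alpha>) * y"
    using Youngs_inequality_0[of \<alpha> "1 - \<alpha>" x y] assms xy by auto
  with xy assms show ?thesis
    by (simp add: ennpowr_ennreal ennreal_mult[symmetric] ennreal_plus[symmetric] ennreal_leI
        del: ennreal_plus)
qed

text \<open>Both sides are homogeneous of degree \<open>\<alpha>\<close> in \<open>f\<close> and of degree \<open>1 - \<alpha>\<close> in \<open>g\<close>, so that both
  integrals may be normalized to 1. The claim is then the
  integral of the weighted inequality between arithmetic and geometric means. In the degenerate cases
  a vanishing integral kills the left-hand side, and otherwise an infinite one makes the right-hand
  side infinite.\<close>

theorem nn_integral_Holder: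
  assumes [measurable]: "f \<in> borel_measurable M" "g \<in> borel_measurable M"
    and \<alpha>: "0 < \<alpha>" "\<alpha> < 1"
  shows "(\<integral>\<^sup>+x. ennpowr (f x) \<alpha> * ennpowr (g x) (1 - \<alpha>) \<partial>M)
    \<le> ennpowr (\<integral>\<^sup>+x. f x \<partial>M) \<alpha> * ennpowr (\<integral>\<^sup>+x. g x \<partial>M) (1 - \<alpha>)"
proof -
  let ?I = "\<integral>\<^sup>+x. f x \<partial>M" and ?J = "\<integral>\<^sup>+x. g x \<partial>M"
  consider "?I = 0" | "?J = 0" | "?I \<noteq> 0" "?J \<noteq> 0" "?I = top \<or> ?J = top"
    | "?I \<noteq> 0" "?J \<noteq> 0" "?I \<noteq> top" "?J \<noteq> top" by auto
  then show ?thesis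
  proof cases
    case 1
    then have "AE x in M. f x = 0" by (subst (asm) nn_integral_0_iff_AE) auto
    then have "(\<integral>\<^sup>+x. ennpowr (f x) \<alpha> * ennpowr (g x) (1 - \<alpha>) \<partial>M) = (\<integral>\<^sup>+x. 0 \<partial>M)"
      by (intro nn_integral_cong_AE) auto
    then show ?thesis by simp
  next
    case 2
    then have "AE x in M. g x = 0" by (subst (asm) nn_integral_0_iff_AE) auto
    then have "(\<integral>\<^sup>+x. ennpowr (f x) \<alpha> * ennpowr (g x) (1 - \<alpha>) \<partial>M) = (\<integral>\<^sup>+x. 0 \<partial>M)"
      by (intro nn_integral_cong_AE) auto
    then show ?thesis by simp
  next
    case 3
    then show ?thesis by (auto simp: ennreal_mult_top ennreal_top_mult)
  next
    case 4
    have eq: "z * (y / z) = y" if "z \<noteq> 0" "z \<noteq> top" for y z :: ennreal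
      using that by (simp add: ennreal_times_divide ennreal_mult_divide_eq mult.commute)
    let ?K = "ennpowr ?I \<alpha> * ennpowr ?J (1 - \<alpha>)"
    have "(\<integral>\<^sup>+x. ennpowr (f x) \<alpha> * ennpowr (g x) (1 - \<alpha>) \<partial>M)
        = (\<integral>\<^sup>+x. ?K * (ennpowr (f x / ?I) \<alpha> * ennpowr (g x / ?J) (1 - \<alpha>)) \<partial>M)"
    proof (intro nn_integral_cong)
      fix x
      have "ennpowr (f x) \<alpha> * ennpowr (g x) (1 - \<alpha>)
          = ennpowr (?I * (f x / ?I)) \<alpha> * ennpowr (?J * (g x / ?J)) (1 - \<alpha>)"
        using 4 by (simp add: eq)
      then show "ennpowr (f x) \<alpha> * ennpowr (g x) (1 - \<alpha>)
          = ?K * (ennpowr (f x / ?I) \<alpha> * ennpowr (g x / ?J) (1 - \<alpha>))"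
        by (simp add: ennpowr_mult ac_simps)
    qed
    also have "\<dots> \<le> (\<integral>\<^sup>+x. ?K * (ennreal \<alpha> * (f x / ?I) + ennreal (1 - \<alpha>) * (g x / ?J)) \<partial>M)"
      by (intro nn_integral_mono mult_left_mono ennpowr_weighted_arith_geo \<alpha>) auto
    also have "\<dots> = ?K * (ennreal \<alpha> * (?I / ?I) + ennreal (1 - \<alpha>) * (?J / ?J))"
      by (simp add: nn_integral_cmult nn_integral_add nn_integral_divide)
    also have "\<dots> = ?K"
      using 4 \<alpha> by (simp add: less_top ennreal_plus[symmetric] del: ennreal_plus)
    finally show ?thesis .
  qed
qed

text \<open>Jensen's inequality for the concave function \<open>x \<mapsto> x\<^sup>\<beta>\<close>, as Holder's inequality against the
  constant 1.\<close>

lemma nn_integral_ennpowr_le: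
  assumes [measurable]: "f \<in> borel_measurable M" "Q \<in> sets M"
    and Q: "emeasure M Q \<noteq> 0" "emeasure M Q \<noteq> top" and \<beta>: "0 < \<beta>" "\<beta> \<le> 1"
  shows "(\<integral>\<^sup>+x\<in>Q. ennpowr (f x) \<beta> \<partial>M)
    \<le> ennpowr (\<integral>\<^sup>+x\<in>Q. f x \<partial>M) \<beta> * ennpowr (emeasure M Q) (1 - \<beta>)"
proof (cases "\<beta> = 1")
  case True
  then show ?thesis
    using Q by (cases "emeasure M Q") (auto simp: ennpowr_ennreal ennreal_eq_0_iff)
next
  case False
  with \<beta> have "\<beta> < 1" by simp
  have "(\<integral>\<^sup>+x\<in>Q. ennpowr (f x) \<beta> \<partial>M)
      = (\<integral>\<^sup>+x. ennpowr (f x * indicator Q x) \<beta> * ennpowr (indicator Q x) (1 - \<beta>) \<partial>M)"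
    by (intro nn_integral_cong) (auto simp: indicator_def)
  also have "\<dots> \<le> ennpowr (\<integral>\<^sup>+x\<in>Q. f x \<partial>M) \<beta> * ennpowr (\<integral>\<^sup>+x. indicator Q x \<partial>M) (1 - \<beta>)"
    using \<beta> \<open>\<beta> < 1\<close> by (intro nn_integral_Holder) auto
  finally show ?thesis by simp
qed

text \<open>Infinitely many summands at once are needed, without loss of a constant. Let \<open>m n\<close> be the norm of
  \<open>f n\<close> and \<open>S\<close> the sum of the \<open>m n\<close>. Holder's inequality on \<open>\<nat>\<close> with the weights \<open>m n\<close> gives, almost
  everywhere, the bound \<open>(\<Sum>n. f n)\<^sup>r \<le> S\<^sup>r\<^sup>-\<^sup>1 (\<Sum>n. (f n)\<^sup>r / (m n)\<^sup>r\<^sup>-\<^sup>1)\<close>, whose integral is at most \<open>S\<^sup>r\<close>.\<close>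

theorem nn_integral_Minkowski_suminf:
  assumes [measurable]: "\<And>n. f n \<in> borel_measurable M" and r: "1 \<le> r"
  shows "ennpowr (\<integral>\<^sup>+x. ennpowr (\<Sum>n. f n x) r \<partial>M) (1 / r)
    \<le> (\<Sum>n. ennpowr (\<integral>\<^sup>+x. ennpowr (f n x) r \<partial>M) (1 / r))"
proof -
  define m where "m n = ennpowr (\<integral>\<^sup>+x. ennpowr (f n x) r \<partial>M) (1 / r)" for n
  have mr: "ennpowr (m n) r = (\<integral>\<^sup>+x. ennpowr (f n x) r \<partial>M)" for n
    using r by (simp add: m_def ennpowr_ennpowr)
  consider "r = 1" | "(\<Sum>n. m n) = top" | "1 < r" "(\<Sum>n. m n) \<noteq> top" using r by linarith
  then show ?thesis
  proof cases
    case 1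
    then show ?thesis by (simp add: nn_integral_suminf)
  next
    case 2
    then show ?thesis by (simp add: m_def)
  next
    case 3
    define S where "S = (\<Sum>n. m n)"
    have mfin: "m n \<noteq> top" for n
    proof
      assume "m n = top"
      then have "top \<le> S" using sum_le_suminf[of m "{n}"] by (simp add: S_def)
      with 3 show False by (simp add: S_def top_unique)
    qed
    have zero: "AE x in M. m n = 0 \<longrightarrow> f n x = 0" for n
    proof (cases "m n = 0")
      case True
      then have "(\<integral>\<^sup>+x. ennpowr (f n x) r \<partial>M) = 0" using mr[of n] by simp
      then have "AE x in M. ennpowr (f n x) r = 0" by (subst (asm) nn_integral_0_iff_AE) auto
      then show ?thesis by auto
    qed auto
    have e: "(1 - 1 / r) * r = r - 1" using 3 by (simp add: field_simps)
    have "AE x in M. \<forall>n. m n = 0 \<longrightarrow> f n x = 0"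
      using zero by (simp add: AE_all_countable)
    then have "AE x in M. ennpowr (\<Sum>n. f n x) r
        \<le> (\<Sum>n. ennpowr (f n x) r / ennpowr (m n) (r - 1)) * ennpowr S (r - 1)"
    proof eventually_elim
      case (elim x)
      let ?F = "\<lambda>n. ennpowr (f n x) r / ennpowr (m n) (r - 1)"
      have split: "f n x \<le> ennpowr (?F n) (1 / r) * ennpowr (m n) (1 - 1 / r)" for n
      proof (cases "m n = 0")
        case False
        have "ennpowr (?F n) (1 / r) = f n x / ennpowr (m n) (1 - 1 / r)"
          using False mfin[of n] 3
          by (simp add: ennpowr_divide ennpowr_ennpowr diff_divide_distrib)
        then show ?thesis
          using False mfin[of n] by (simp add: ennreal_divide_times ennreal_divide_self less_top)
      qed (use elim in auto)
      have "(\<Sum>n. f n x) \<le> (\<integral>\<^sup>+n. ennpowr (?F n) (1 / r) * ennpowr (m n) (1 - 1 / r) \<partial>count_space UNIV)"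
        unfolding nn_integral_count_space_nat by (intro suminf_le split) auto
      also have "\<dots> \<le> ennpowr (\<Sum>n. ?F n) (1 / r) * ennpowr S (1 - 1 / r)"
        unfolding S_def nn_integral_count_space_nat[symmetric]
        using 3 by (intro nn_integral_Holder) auto
      finally have "ennpowr (\<Sum>n. f n x) r \<le> ennpowr (ennpowr (\<Sum>n. ?F n) (1 / r) * ennpowr S (1 - 1 / r)) r"
        using r by (intro ennpowr_mono) auto
      also have "\<dots> = (\<Sum>n. ?F n) * ennpowr S (r - 1)"
        using 3 by (simp add: ennpowr_mult ennpowr_ennpowr e)
      finally show ?case .
    qed
    then have "(\<integral>\<^sup>+x. ennpowr (\<Sum>n. f n x) r \<partial>M)
        \<le> (\<integral>\<^sup>+x. (\<Sum>n. ennpowr (f n x) r / ennpowr (m n) (r - 1)) * ennpowr S (r - 1) \<partial>M)"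
      by (rule nn_integral_mono_AE)
    also have "\<dots> = (\<Sum>n. ennpowr (m n) r / ennpowr (m n) (r - 1)) * ennpowr S (r - 1)"
      by (simp add: nn_integral_multc nn_integral_suminf nn_integral_divide mr)
    also have "(\<Sum>n. ennpowr (m n) r / ennpowr (m n) (r - 1)) = S"
      unfolding S_def
    proof (intro suminf_cong)
      fix n
      have "ennpowr (m n) r = m n * ennpowr (m n) (r - 1)"
        using ennpowr_add[of "m n" 1 "r - 1"] by simp
      then show "ennpowr (m n) r / ennpowr (m n) (r - 1) = m n"
        using mfin[of n] by (cases "m n = 0") (auto simp: ennreal_mult_divide_eq)
    qed
    also have "S * ennpowr S (r - 1) = ennpowr S r"
      using ennpowr_add[of S 1 "r - 1"] by simp
    finally have "ennpowr (\<integral>\<^sup>+x. ennpowr (\<Sum>n. f n x) r \<partial>M) (1 / r) \<le> ennpowr (ennpowr S r) (1 / r)"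
      using r by (intro ennpowr_mono) auto
    then show ?thesis
      using r by (simp add: ennpowr_ennpowr S_def m_def)
  qed
qed

section \<open>Cubes\<close>

(* As a rewrite rule, the following fact would turn the volume of a cube into the Borel measure of
   its main part before the volume formula can apply. *)
declare emeasure_completion [simp del]

text \<open>Cubes are indexed by centre and half the side length, so that a dilation about the centre
  only changes the second parameter.\<close>

definition qcube :: "'a::euclidean_space \<Rightarrow> real \<Rightarrow> 'a set" where
  "qcube c \<rho> = cbox (c - \<rho> *\<^sub>R One) (c + \<rho> *\<^sub>R One)"

lemma mem_qcube: "x \<in> qcube c \<rho> \<longleftrightarrow> (\<forall>i\<in>Basis. \<bar>x \<bullet> i - c \<bullet> i\<bar> \<le> \<rho>)"
  by (auto simp: qcube_def mem_box algebra_simps abs_le_iff)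

lemma cubes_eq_qcube: "cubes = {qcube c \<rho> | c \<rho>. 0 < \<rho>}"
proof safe
  fix Q :: "'a set" assume "Q \<in> cubes"
  then obtain a l where Q: "Q = cbox a (a + l *\<^sub>R One)" "0 < l"
    by (auto simp: cubes_def)
  have "Q = qcube (a + (l / 2) *\<^sub>R One) (l / 2)"
    by (simp add: Q qcube_def add.assoc scaleR_add_left[symmetric])
  with Q show "\<exists>c \<rho>. Q = qcube c \<rho> \<and> 0 < \<rho>"
    by (intro exI[of _ "a + (l / 2) *\<^sub>R One"] exI[of _ "l / 2"]) auto
next
  fix c :: 'a and \<rho> :: real assume "0 < \<rho>"
  then show "qcube c \<rho> \<in> cubes"
    unfolding cubes_def qcube_def
    by (intro CollectI exI[of _ "c - \<rho> *\<^sub>R One"] exI[of _ "2 * \<rho>"])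
      (auto simp: algebra_simps scaleR_2 simp flip: scaleR_scaleR)
qed

lemma qcube_in_cubes: "0 < \<rho> \<Longrightarrow> qcube c \<rho> \<in> cubes"
  by (auto simp: cubes_eq_qcube)

lemma sets_qcube [measurable, simp]: "qcube c \<rho> \<in> sets lebesgue"
  by (simp add: qcube_def)

lemma qcube_mono: "\<rho> \<le> \<rho>' \<Longrightarrow> qcube c \<rho> \<subseteq> qcube c \<rho>'"
  by (fastforce simp: mem_qcube)

lemma emeasure_qcube:
  fixes c :: "'a::euclidean_space"
  assumes "0 \<le> \<rho>"
  shows "emeasure lebesgue (qcube c \<rho>) = ennreal ((2 * \<rho>) ^ DIM('a))"
proof -
  have "emeasure lebesgue (qcube c \<rho>) = ennreal (\<Prod>b\<in>(Basis::'a set). 2 * \<rho>)"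
    using assms by (simp add: qcube_def emeasure_completion emeasure_lborel_cbox_eq algebra_simps)
  then show ?thesis by simp
qed

lemma emeasure_qcube_pos_finite:
  fixes c :: "'a::euclidean_space"
  assumes "0 < \<rho>"
  shows "emeasure lebesgue (qcube c \<rho>) \<noteq> 0" "emeasure lebesgue (qcube c \<rho>) \<noteq> top"
  using assms by (simp_all add: emeasure_qcube ennreal_eq_0_iff not_le)

lemma qcube_exhaust: "\<exists>n. x \<in> qcube 0 (real (Suc n))"
proof -
  obtain n :: nat where n: "norm x \<le> real n" using real_arch_simple by blast
  have "x \<in> qcube 0 (real (Suc n))"
    unfolding mem_qcube using n Basis_le_norm[of _ x] by force
  then show ?thesis by blast
qed

lemma qcube_subset_triple:
  assumes "qcube c \<rho> \<inter> qcube c' \<rho>' \<noteq> {}" "\<rho> \<le> \<rho>'"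
  shows "qcube c \<rho> \<subseteq> qcube c' (3 * \<rho>')"
proof
  fix x assume x: "x \<in> qcube c \<rho>"
  from assms obtain y where y: "y \<in> qcube c \<rho>" "y \<in> qcube c' \<rho>'" by auto
  show "x \<in> qcube c' (3 * \<rho>')"
    unfolding mem_qcube
  proof
    fix i :: 'a assume "i \<in> Basis"
    with x y have "\<bar>x \<bullet> i - c \<bullet> i\<bar> \<le> \<rho>" "\<bar>y \<bullet> i - c \<bullet> i\<bar> \<le> \<rho>" "\<bar>y \<bullet> i - c' \<bullet> i\<bar> \<le> \<rho>'"
      by (auto simp: mem_qcube)
    with assms(2) show "\<bar>x \<bullet> i - c' \<bullet> i\<bar> \<le> 3 * \<rho>'" by linarith
  qed
qed

text \<open>Greedy selection: a largest cube, once tripled, swallows every cube that it meets, and the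
  cubes that it does not meet form a smaller family.\<close>

lemma Vitali_finite_cubes:
  fixes I :: "('a::euclidean_space \<times> real) set"
  assumes "finite I"
  shows "\<exists>J\<subseteq>I. disjoint_family_on (\<lambda>(c, \<rho>). qcube c \<rho>) J
    \<and> (\<Union>(c, \<rho>)\<in>I. qcube c \<rho>) \<subseteq> (\<Union>(c, \<rho>)\<in>J. qcube c (3 * \<rho>))"
  using assms
proof (induction "card I" arbitrary: I rule: less_induct)
  case less
  show ?case
  proof (cases "I = {}")
    case False
    have "Max (snd ` I) \<in> snd ` I" using less.prems False by (intro Max_in) auto
    then obtain c \<rho> where max: "(c, \<rho>) \<in> I" "\<rho> = Max (snd ` I)" by auto
    then have big: "\<rho>' \<le> \<rho>" if "(c', \<rho>') \<in> I" for c' \<rho>'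
      using less.prems that by (force intro!: Max_ge)
    define I' where "I' = {(c', \<rho>') \<in> I. qcube c' \<rho>' \<inter> qcube c \<rho> = {}} - {(c, \<rho>)}"
    have "I' \<subset> I" using max by (auto simp: I'_def)
    then have "card I' < card I" "finite I'"
      using less.prems by (auto intro: psubset_card_mono finite_subset)
    from less.hyps[OF this] obtain J where J: "J \<subseteq> I'"
      "disjoint_family_on (\<lambda>(c, \<rho>). qcube c \<rho>) J"
      "(\<Union>(c, \<rho>)\<in>I'. qcube c \<rho>) \<subseteq> (\<Union>(c, \<rho>)\<in>J. qcube c (3 * \<rho>))" by auto
    have "disjoint_family_on (\<lambda>(c, \<rho>). qcube c \<rho>) (insert (c, \<rho>) J)"
      using J(1,2) by (fastforce simp: disjoint_family_on_def I'_def)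
    moreover have "qcube c' \<rho>' \<subseteq> (\<Union>(c, \<rho>)\<in>insert (c, \<rho>) J. qcube c (3 * \<rho>))"
      if I: "(c', \<rho>') \<in> I" for c' \<rho>'
    proof (cases "qcube c' \<rho>' \<inter> qcube c \<rho> = {} \<and> (c', \<rho>') \<noteq> (c, \<rho>)")
      case True
      then have "(c', \<rho>') \<in> I'" using I by (auto simp: I'_def)
      then have "qcube c' \<rho>' \<subseteq> (\<Union>(c, \<rho>)\<in>I'. qcube c \<rho>)" by auto
      then show ?thesis using J(3) by auto
    next
      case False
      have "qcube c' \<rho>' \<subseteq> qcube c (3 * \<rho>)"
        using qcube_subset_triple[of c' \<rho>' c \<rho>] False big[OF I]
        by (cases "qcube c' \<rho>' = {}") auto
      then show ?thesis by auto
    qed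
    ultimately show ?thesis
      using J(1) \<open>I' \<subset> I\<close> max
      by (intro exI[of _ "insert (c, \<rho>) J"]) blast
  qed (auto simp: disjoint_family_on_def)
qed

text \<open>A supremum over countably many cubes is measurable, and is exhausted by finite subfamilies. A
  family that approximates every cube from outside gives the same maximal function as the family of
  all cubes.\<close>

lemma countable_qcube_family:
  obtains \<D> :: "('a::euclidean_space \<times> real) set"
  where "countable \<D>" "\<And>c \<rho>. (c, \<rho>) \<in> \<D> \<Longrightarrow> 0 < \<rho>"
    "\<And>c \<rho> \<epsilon>. 0 < \<rho> \<Longrightarrow> 0 < \<epsilon> \<Longrightarrow>
      \<exists>c' \<rho>'. (c', \<rho>') \<in> \<D> \<and> qcube c \<rho> \<subseteq> qcube c' \<rho>' \<and> \<rho>' \<le> \<rho> + \<epsilon>"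
proof -
  obtain D :: "'a set" where D: "countable D" "\<And>X. open X \<Longrightarrow> X \<noteq> {} \<Longrightarrow> \<exists>d\<in>D. d \<in> X"
    by (rule countable_dense_setE) auto
  define \<D> where "\<D> = D \<times> {\<rho>::real. \<rho> \<in> \<rat> \<and> 0 < \<rho>}"
  show ?thesis
  proof (rule that[of \<D>])
    show "countable \<D>"
      unfolding \<D>_def using D(1) countable_rat
      by (intro countable_SIGMA) (auto intro: countable_subset)
  next
    fix c :: 'a and \<rho> \<epsilon> :: real assume pos: "0 < \<rho>" "0 < \<epsilon>"
    obtain c' where c': "c' \<in> D" "c' \<in> ball c (\<epsilon> / 2)"
      using D(2)[of "ball c (\<epsilon> / 2)"] pos by auto
    obtain \<rho>' where \<rho>': "\<rho>' \<in> \<rat>" "\<rho> + \<epsilon> / 2 < \<rho>'" "\<rho>' < \<rho> + \<epsilon>"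
      using Rats_dense_in_real[of "\<rho> + \<epsilon> / 2" "\<rho> + \<epsilon>"] pos by auto
    have "qcube c \<rho> \<subseteq> qcube c' \<rho>'"
    proof
      fix x assume x: "x \<in> qcube c \<rho>"
      show "x \<in> qcube c' \<rho>'"
        unfolding mem_qcube
      proof
        fix i :: 'a assume i: "i \<in> Basis"
        have "\<bar>(c - c') \<bullet> i\<bar> \<le> norm (c - c')" using i by (rule Basis_le_norm)
        then have "\<bar>c \<bullet> i - c' \<bullet> i\<bar> < \<epsilon> / 2"
          using c' by (simp add: dist_norm inner_diff_left)
        moreover have "\<bar>x \<bullet> i - c \<bullet> i\<bar> \<le> \<rho>" using x i by (simp add: mem_qcube)
        ultimately show "\<bar>x \<bullet> i - c' \<bullet> i\<bar> \<le> \<rho>'" using \<rho>' by linarith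
      qed
    qed
    then show "\<exists>c' \<rho>'. (c', \<rho>') \<in> \<D> \<and> qcube c \<rho> \<subseteq> qcube c' \<rho>' \<and> \<rho>' \<le> \<rho> + \<epsilon>"
      using c' \<rho>' pos by (intro exI[of _ c'] exI[of _ \<rho>']) (auto simp: \<D>_def)
  qed (auto simp: \<D>_def)
qed

section \<open>Maximal operators for doubling measures\<close>

definition maxop ::
  "('a::euclidean_space \<times> real) set \<Rightarrow> 'a measure \<Rightarrow> ('a \<Rightarrow> ennreal) \<Rightarrow> 'a \<Rightarrow> ennreal" where
  "maxop \<D> M g x = (SUP (c, \<rho>)\<in>\<D>.
     (\<integral>\<^sup>+y\<in>qcube c \<rho>. g y \<partial>M) / emeasure M (qcube c \<rho>) * indicator (qcube c \<rho>) x)"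

lemma measurable_maxop:
  assumes "countable \<D>" "sets M = sets lebesgue"
  shows "maxop \<D> M g \<in> borel_measurable M"
proof -
  have [measurable]: "qcube c \<rho> \<in> sets M" for c \<rho> by (simp add: assms)
  show ?thesis
    unfolding maxop_def
    by (intro borel_measurable_SUP assms) (auto split: prod.split)
qed

lemma average_le_maxop:
  assumes "(c, \<rho>) \<in> \<D>" "x \<in> qcube c \<rho>"
  shows "(\<integral>\<^sup>+y\<in>qcube c \<rho>. g y \<partial>M) / emeasure M (qcube c \<rho>) \<le> maxop \<D> M g x"
  unfolding maxop_def by (rule SUP_upper2[OF assms(1)]) (use assms in auto)

text \<open>The cubes on which the average of \<open>g\<close> exceeds \<open>l\<close> cover the level set. Of finitely many of
  them, the Vitali selection keeps disjoint ones whose triples still cover; doubling compares the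
  triples with the cubes themselves, on which \<open>l\<close> times the measure is at most the integral of \<open>g\<close>.
  Countability of the family allows the passage to the whole union.\<close>

lemma maxop_weak_type:
  fixes \<D> :: "('a::euclidean_space \<times> real) set"
  assumes \<D>: "countable \<D>" and M: "sets M = sets lebesgue"
    and D: "\<And>c \<rho>. (c, \<rho>) \<in> \<D> \<Longrightarrow>
      emeasure M (qcube c (3 * \<rho>)) \<le> ennreal D * emeasure M (qcube c \<rho>)"
    and g [measurable]: "g \<in> borel_measurable M"
  shows "l * emeasure M {x. l < maxop \<D> M g x} \<le> ennreal D * (\<integral>\<^sup>+x. g x \<partial>M)"
proof -
  have [measurable]: "qcube c \<rho> \<in> sets M" for c \<rho> by (simp add: M)
  define B where "B = {(c, \<rho>) \<in> \<D>. l * emeasure M (qcube c \<rho>) \<le> (\<integral>\<^sup>+y\<in>qcube c \<rho>. g y \<partial>M)}"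
  let ?Q = "\<lambda>(c, \<rho>). qcube c \<rho> :: 'a set"
  have fin: "l * emeasure M (\<Union>i\<in>F. ?Q i) \<le> ennreal D * (\<integral>\<^sup>+x. g x \<partial>M)"
    if F: "finite F" "F \<subseteq> B" for F
  proof -
    obtain J where J: "J \<subseteq> F" "disjoint_family_on ?Q J"
      "(\<Union>i\<in>F. ?Q i) \<subseteq> (\<Union>(c, \<rho>)\<in>J. qcube c (3 * \<rho>))"
      using Vitali_finite_cubes[OF F(1)] by (auto simp: split_def)
    have finJ: "finite J" using J F by (auto intro: finite_subset)
    have "emeasure M (\<Union>i\<in>F. ?Q i) \<le> emeasure M (\<Union>(c, \<rho>)\<in>J. qcube c (3 * \<rho>))"
      using finJ by (intro emeasure_mono J(3)) (auto intro!: sets.finite_UN)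
    also have "\<dots> \<le> (\<Sum>i\<in>J. emeasure M (case i of (c, \<rho>) \<Rightarrow> qcube c (3 * \<rho>)))"
      using finJ by (intro emeasure_subadditive_finite) auto
    also have "\<dots> \<le> (\<Sum>i\<in>J. ennreal D * emeasure M (?Q i))"
      using J F by (intro sum_mono) (auto simp: B_def split: prod.split intro!: D)
    finally have "l * emeasure M (\<Union>i\<in>F. ?Q i)
        \<le> l * (\<Sum>i\<in>J. ennreal D * emeasure M (?Q i))"
      by (rule mult_left_mono) auto
    also have "\<dots> = ennreal D * (\<Sum>i\<in>J. l * emeasure M (?Q i))"
      by (simp add: sum_distrib_left ac_simps)
    also have "\<dots> \<le> ennreal D * (\<Sum>i\<in>J. \<integral>\<^sup>+y\<in>?Q i. g y \<partial>M)"
      using J F by (intro mult_left_mono sum_mono) (auto simp: B_def)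
    also have "(\<Sum>i\<in>J. \<integral>\<^sup>+y\<in>?Q i. g y \<partial>M) = (\<integral>\<^sup>+y\<in>(\<Union>i\<in>J. ?Q i). g y \<partial>M)"
      by (subst nn_integral_sum[symmetric])
        (auto simp: sum_distrib_left[symmetric] indicator_UN_disjoint[OF finJ J(2)])
    also have "ennreal D * (\<integral>\<^sup>+y\<in>(\<Union>i\<in>J. ?Q i). g y \<partial>M) \<le> ennreal D * (\<integral>\<^sup>+x. g x \<partial>M)"
      by (intro mult_left_mono nn_integral_mono) (auto simp: indicator_def)
    finally show ?thesis .
  qed
  have "{x. l < maxop \<D> M g x} \<subseteq> (\<Union>i\<in>B. ?Q i)"
  proof safe
    fix x assume "l < maxop \<D> M g x"
    then obtain c \<rho> where c: "(c, \<rho>) \<in> \<D>"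
      "l < (\<integral>\<^sup>+y\<in>qcube c \<rho>. g y \<partial>M) / emeasure M (qcube c \<rho>) * indicator (qcube c \<rho>) x"
      unfolding maxop_def less_SUP_iff by auto
    then have x: "x \<in> qcube c \<rho>"
      and l: "l < (\<integral>\<^sup>+y\<in>qcube c \<rho>. g y \<partial>M) / emeasure M (qcube c \<rho>)"
      by (cases "x \<in> qcube c \<rho>"; simp)+
    have "l * emeasure M (qcube c \<rho>) \<le> (\<integral>\<^sup>+y\<in>qcube c \<rho>. g y \<partial>M)"
    proof (cases "emeasure M (qcube c \<rho>) = 0 \<or> emeasure M (qcube c \<rho>) = top")
      case False
      have "l * emeasure M (qcube c \<rho>)
          \<le> (\<integral>\<^sup>+y\<in>qcube c \<rho>. g y \<partial>M) / emeasure M (qcube c \<rho>) * emeasure M (qcube c \<rho>)"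
        using l by (intro mult_right_mono) auto
      with False show ?thesis by (simp add: ennreal_divide_times less_top)
    qed (use l in auto)
    with c x show "x \<in> (\<Union>i\<in>B. ?Q i)" by (auto simp: B_def)
  qed
  then have "emeasure M {x. l < maxop \<D> M g x} \<le> emeasure M (\<Union>i\<in>B. ?Q i)"
    using \<D> by (intro emeasure_mono sets.countable_UN'') (auto simp: B_def intro: countable_subset)
  then have "l * emeasure M {x. l < maxop \<D> M g x} \<le> l * emeasure M (\<Union>i\<in>B. ?Q i)"
    by (rule mult_left_mono) auto
  also have "\<dots> \<le> ennreal D * (\<integral>\<^sup>+x. g x \<partial>M)"
  proof (cases "B = {}")
    case False
    have cB: "countable B" using \<D> by (auto simp: B_def intro: countable_subset)
    define U where "U n = (\<Union>i\<in>from_nat_into B ` {..n}. ?Q i)" for n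
    have UB: "(\<Union>n. U n) = (\<Union>i\<in>B. ?Q i)"
    proof -
      have "(\<Union>n::nat. \<Union>i\<in>h ` {..n}. q i) = (\<Union>i\<in>range h. q i)"
        for h :: "nat \<Rightarrow> 'a \<times> real" and q :: "'a \<times> real \<Rightarrow> 'a set" by auto
      then have "(\<Union>n. U n) = (\<Union>i\<in>range (from_nat_into B). ?Q i)"
        unfolding U_def .
      then show ?thesis using cB False by (simp add: range_from_nat_into)
    qed
    have Us: "range U \<subseteq> sets M"
      by (auto simp: U_def split: prod.split intro!: sets.finite_UN)
    have "incseq U"
      unfolding incseq_def U_def by (intro allI impI UN_mono image_mono) auto
    have "l * emeasure M (\<Union>i\<in>B. ?Q i) = (SUP n. l * emeasure M (U n))"
      using SUP_emeasure_incseq[OF Us \<open>incseq U\<close>] by (simp add: UB SUP_mult_left_ennreal[symmetric])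
    also have "\<dots> \<le> ennreal D * (\<integral>\<^sup>+x. g x \<partial>M)"
      using False unfolding U_def by (intro SUP_least fin) (auto intro: from_nat_into)
    finally show ?thesis .
  qed simp
  finally show ?thesis .
qed

lemma ennpowr_layer_cake:
  assumes e: "0 < e"
  shows "ennpowr y e
    = (\<integral>\<^sup>+l. ennreal (e * l powr (e - 1)) * indicator {l. 0 < l \<and> ennreal l < y} l \<partial>lborel)"
proof -
  have fin: "(\<integral>\<^sup>+l. ennreal (e * l powr (e - 1)) * indicator {0<..<c} l \<partial>lborel) = ennreal (c powr e)"
    if "0 \<le> c" for c
  proof -
    have "((\<lambda>l. e * l powr (e - 1)) has_integral (e * (c powr (e - 1 + 1) / (e - 1 + 1)))) {0..c}"
      using has_integral_powr_from_0[of "e - 1" c] that e by (intro has_integral_mult_right) auto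
    then have "((\<lambda>l. e * l powr (e - 1)) has_integral (c powr e)) {0<..<c}"
      using e by (simp add: has_integral_Icc_iff_Ioo)
    then show ?thesis
      using e by (intro nn_integral_has_integral_lebesgue') auto
  qed
  show ?thesis
  proof (cases y)
    case (real c)
    then have "{l. 0 < l \<and> ennreal l < y} = {0<..<c}" by (auto simp: ennreal_less_iff)
    then show ?thesis using real fin by (simp add: ennpowr_ennreal)
  next
    case top
    let ?I = "\<integral>\<^sup>+l. ennreal (e * l powr (e - 1)) * indicator {l. 0 < l \<and> ennreal l < y} l \<partial>lborel"
    have "of_nat n \<le> ?I" for n
    proof -
      have "of_nat n = ennreal ((real n powr (1 / e)) powr e)"
        using e by (simp add: powr_powr ennreal_of_nat_eq_real_of_nat)
      also have "\<dots> = (\<integral>\<^sup>+l. ennreal (e * l powr (e - 1)) * indicator {0<..<real n powr (1 / e)} l \<partial>lborel)"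
        by (subst fin) auto
      also have "\<dots> \<le> ?I"
        using top by (intro nn_integral_mono) (auto simp: indicator_def)
      finally show ?thesis .
    qed
    then have "?I = top" by (metis ennreal_Ex_less_of_nat less_top not_le)
    then show ?thesis using top by simp
  qed
qed

text \<open>Marcinkiewicz interpolation between the weak bound and the trivial bound on bounded
  functions. The part of \<open>g\<close> below \<open>l / 2\<close> contributes at most \<open>l / 2\<close> to the maximal function, so the level
  set at \<open>l\<close> is controlled by the part above \<open>l / 2\<close>. Integrating the weak bound over \<open>l\<close>, exchanging
  the integrals and applying the layer cake formula with the exponent \<open>s - 1\<close> gives the claim; this
  exponent must be positive.\<close>

theorem maxop_strong_type:
  fixes \<D> :: "('a::euclidean_space \<times> real) set"
  assumes \<D>: "countable \<D>" and M: "sets M = sets lebesgue" "sigma_finite_measure M"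
    and D: "0 \<le> D" "\<And>c \<rho>. (c, \<rho>) \<in> \<D> \<Longrightarrow>
      emeasure M (qcube c (3 * \<rho>)) \<le> ennreal D * emeasure M (qcube c \<rho>)"
    and g [measurable]: "g \<in> borel_measurable M"
    and s: "1 < s"
  shows "(\<integral>\<^sup>+x. ennpowr (maxop \<D> M g x) s \<partial>M)
    \<le> ennreal (D * (s / (s - 1)) * 2 powr s) * (\<integral>\<^sup>+x. ennpowr (g x) s \<partial>M)"
proof -
  interpret M: sigma_finite_measure M by fact
  interpret P: pair_sigma_finite M "lborel :: real measure" ..
  have [measurable]: "qcube c \<rho> \<in> sets M" for c \<rho> by (simp add: M)
  have [measurable]: "maxop \<D> M g \<in> borel_measurable M" by (rule measurable_maxop[OF \<D> M(1)])
  have sp: "space M = UNIV" using sets_eq_imp_space_eq[OF M(1)] by simp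
  have weak: "ennreal l * emeasure M {x. ennreal l < maxop \<D> M g x}
      \<le> ennreal (2 * D) * (\<integral>\<^sup>+x. g x * indicator {x. ennreal l < 2 * g x} x \<partial>M)"
    if l: "0 < l" for l :: real
  proof -
    \<comment> \<open>The part of \<open>g\<close> above \<open>l / 2\<close>, written without a division of \<open>l\<close>.\<close>
    let ?h = "\<lambda>x. g x * indicator {x. ennreal l < 2 * g x} x"
    have split: "g y \<le> ?h y + ennreal (l / 2)" for y
    proof (cases "ennreal l < 2 * g y")
      case False
      then show ?thesis
        using l by (cases "g y") (auto simp: ennreal_mult_top numeral_mult_ennreal not_less
            ennreal_le_iff ennreal_leI)
    qed auto
    have le: "maxop \<D> M g x \<le> maxop \<D> M ?h x + ennreal (l / 2)" for x
      unfolding maxop_def[of \<D> M g]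
    proof (rule SUP_least, clarify)
      fix c \<rho> assume c: "(c, \<rho>) \<in> \<D>"
      let ?Q = "qcube c \<rho>"
      show "(\<integral>\<^sup>+y\<in>?Q. g y \<partial>M) / emeasure M ?Q * indicator ?Q x
          \<le> maxop \<D> M ?h x + ennreal (l / 2)"
      proof (cases "x \<in> ?Q")
        case True
        have "(\<integral>\<^sup>+y\<in>?Q. g y \<partial>M) \<le> (\<integral>\<^sup>+y. ?h y * indicator ?Q y + ennreal (l / 2) * indicator ?Q y \<partial>M)"
          using split by (intro nn_integral_mono) (auto simp: indicator_def)
        also have "\<dots> = (\<integral>\<^sup>+y\<in>?Q. ?h y \<partial>M) + ennreal (l / 2) * emeasure M ?Q"
          by (subst nn_integral_add) (auto simp: nn_integral_cmult_indicator)
        finally have "(\<integral>\<^sup>+y\<in>?Q. g y \<partial>M) / emeasure M ?Q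
            \<le> (\<integral>\<^sup>+y\<in>?Q. ?h y \<partial>M) / emeasure M ?Q + ennreal (l / 2) * emeasure M ?Q / emeasure M ?Q"
          unfolding add_divide_distrib_ennreal[symmetric] by (rule divide_right_mono_ennreal)
        also have "\<dots> \<le> maxop \<D> M ?h x + ennreal (l / 2)"
        proof (intro add_mono average_le_maxop c True)
          show "ennreal (l / 2) * emeasure M ?Q / emeasure M ?Q \<le> ennreal (l / 2)"
            by (cases "emeasure M ?Q = 0 \<or> emeasure M ?Q = top")
              (auto simp: ennreal_mult_divide_eq)
        qed
        finally show ?thesis using True by simp
      qed auto
    qed
    have sub: "{x. ennreal l < maxop \<D> M g x} \<subseteq> {x. ennreal (l / 2) < maxop \<D> M ?h x}"
    proof safe
      fix x assume "ennreal l < maxop \<D> M g x"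
      also note le
      finally show "ennreal (l / 2) < maxop \<D> M ?h x"
        using l by (cases "maxop \<D> M ?h x")
          (auto simp: ennreal_less_iff ennreal_plus[symmetric] simp del: ennreal_plus)
    qed
    have "maxop \<D> M ?h \<in> borel_measurable M" by (rule measurable_maxop[OF \<D> M(1)])
    from borel_measurable_less[OF borel_measurable_const this]
    have ms: "{x. ennreal (l / 2) < maxop \<D> M ?h x} \<in> sets M"
      using sp by simp
    have "ennreal l * emeasure M {x. ennreal l < maxop \<D> M g x}
        \<le> 2 * (ennreal (l / 2) * emeasure M {x. ennreal (l / 2) < maxop \<D> M ?h x})"
      using l emeasure_mono[OF sub ms]
      by (simp add: mult.assoc[symmetric] numeral_mult_ennreal mult_left_mono)
    also have "\<dots> \<le> 2 * (ennreal D * (\<integral>\<^sup>+x. ?h x \<partial>M))"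
    proof (intro mult_left_mono maxop_weak_type[OF \<D> M(1) D(2)])
      show "?h \<in> borel_measurable M" using sp by measurable
    qed auto
    finally show ?thesis using D(1) by (simp add: mult.assoc[symmetric] numeral_mult_ennreal)
  qed
  have "(\<integral>\<^sup>+x. ennpowr (maxop \<D> M g x) s \<partial>M)
      = (\<integral>\<^sup>+x. (\<integral>\<^sup>+l. ennreal (s * l powr (s - 1))
          * indicator {l. 0 < l \<and> ennreal l < maxop \<D> M g x} l \<partial>lborel) \<partial>M)"
    using s by (subst ennpowr_layer_cake) auto
  also have "\<dots> = (\<integral>\<^sup>+l. (\<integral>\<^sup>+x. ennreal (s * l powr (s - 1))
          * indicator {l. 0 < l \<and> ennreal l < maxop \<D> M g x} l \<partial>M) \<partial>lborel)"
    by (rule P.Fubini'[symmetric]) (unfold indicator_def, measurable)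
  also have "\<dots> \<le> (\<integral>\<^sup>+l. (\<integral>\<^sup>+x. ennreal (2 * D * (s / (s - 1))) * (g x * (ennreal ((s - 1) * l powr (s - 1 - 1))
          * indicator {l. 0 < l \<and> ennreal l < 2 * g x} l)) \<partial>M) \<partial>lborel)"
  proof (rule nn_integral_mono)
    fix l :: real
    show "(\<integral>\<^sup>+x. ennreal (s * l powr (s - 1)) * indicator {l. 0 < l \<and> ennreal l < maxop \<D> M g x} l \<partial>M)
       \<le> (\<integral>\<^sup>+x. ennreal (2 * D * (s / (s - 1))) * (g x * (ennreal ((s - 1) * l powr (s - 1 - 1))
          * indicator {l. 0 < l \<and> ennreal l < 2 * g x} l)) \<partial>M)"
    proof (cases "0 < l")
      case True
      have 1: "(\<integral>\<^sup>+x. ennreal (s * l powr (s - 1)) * indicator {l. 0 < l \<and> ennreal l < maxop \<D> M g x} l \<partial>M)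
          = ennreal (s * l powr (s - 1)) * emeasure M {x. ennreal l < maxop \<D> M g x}"
      proof -
        have "{x. ennreal l < maxop \<D> M g x} \<in> sets M"
          using borel_measurable_less[of "\<lambda>_. ennreal l" M "maxop \<D> M g"] sp by simp
        then have "(\<integral>\<^sup>+x. ennreal (s * l powr (s - 1)) * indicator {x. ennreal l < maxop \<D> M g x} x \<partial>M)
          = ennreal (s * l powr (s - 1)) * emeasure M {x. ennreal l < maxop \<D> M g x}"
          by (rule nn_integral_cmult_indicator)
        then show ?thesis using True by (simp add: indicator_def)
      qed
      have "s * l powr (s - 1) = s * l powr (s - 1 - 1) * l"
        using True by (simp add: powr_diff power2_eq_square)
      then have "ennreal (s * l powr (s - 1)) * emeasure M {x. ennreal l < maxop \<D> M g x}
          = ennreal (s * l powr (s - 1 - 1)) * (ennreal l * emeasure M {x. ennreal l < maxop \<D> M g x})"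
        using s True by (simp add: ennreal_mult mult.assoc)
      also have "\<dots> \<le> ennreal (s * l powr (s - 1 - 1))
          * (ennreal (2 * D) * (\<integral>\<^sup>+x. g x * indicator {x. ennreal l < 2 * g x} x \<partial>M))"
        by (intro mult_left_mono weak True) auto
      also have "\<dots> = ennreal (s * l powr (s - 1 - 1) * (2 * D))
          * (\<integral>\<^sup>+x. g x * indicator {x. ennreal l < 2 * g x} x \<partial>M)"
        using s D(1) by (simp add: ennreal_mult mult.assoc)
      also have "\<dots> = (\<integral>\<^sup>+x. ennreal (s * l powr (s - 1 - 1) * (2 * D))
          * (g x * indicator {x. ennreal l < 2 * g x} x) \<partial>M)"
        using sp by (intro nn_integral_cmult[symmetric]) measurable
      also have "s * l powr (s - 1 - 1) * (2 * D)
          = 2 * D * (s / (s - 1)) * ((s - 1) * l powr (s - 1 - 1))"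
        using s by simp
      also have "ennreal \<dots> = ennreal (2 * D * (s / (s - 1))) * ennreal ((s - 1) * l powr (s - 1 - 1))"
        using s D by (intro ennreal_mult) auto
      finally show ?thesis
        unfolding 1 using True by (simp add: ac_simps indicator_def)
    qed simp
  qed
  also have "\<dots> = (\<integral>\<^sup>+x. (\<integral>\<^sup>+l. ennreal (2 * D * (s / (s - 1))) * (g x * (ennreal ((s - 1) * l powr (s - 1 - 1))
          * indicator {l. 0 < l \<and> ennreal l < 2 * g x} l)) \<partial>lborel) \<partial>M)"
    by (rule P.Fubini') (unfold indicator_def, measurable)
  also have "\<dots> = (\<integral>\<^sup>+x. ennreal (2 * D * (s / (s - 1))) * (g x * ennpowr (2 * g x) (s - 1)) \<partial>M)"
    using s by (subst ennpowr_layer_cake) (auto simp: nn_integral_cmult)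
  also have "\<dots> = (\<integral>\<^sup>+x. ennreal (D * (s / (s - 1)) * 2 powr s) * ennpowr (g x) s \<partial>M)"
  proof (intro nn_integral_cong)
    fix x
    have "2 * D * (s / (s - 1)) * 2 powr (s - 1) = D * (s / (s - 1)) * 2 powr s"
      using s by (simp add: powr_diff field_simps)
    then have "ennreal (2 * D * (s / (s - 1))) * ennreal (2 powr (s - 1))
        = ennreal (D * (s / (s - 1)) * 2 powr s)"
      using s D by (simp add: ennreal_mult'[symmetric])
    moreover have "ennpowr 2 (s - 1) = ennreal (2 powr (s - 1))"
      using ennpowr_ennreal[of 2 "s - 1"] by simp
    moreover have "g x * ennpowr (g x) (s - 1) = ennpowr (g x) s"
      using ennpowr_add[of "g x" 1 "s - 1"] by simp
    ultimately show "ennreal (2 * D * (s / (s - 1))) * (g x * ennpowr (2 * g x) (s - 1))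
        = ennreal (D * (s / (s - 1)) * 2 powr s) * ennpowr (g x) s"
      by (simp add: ennpowr_mult) (metis mult.assoc mult.commute)
  qed
  also have "\<dots> = ennreal (D * (s / (s - 1)) * 2 powr s) * (\<integral>\<^sup>+x. ennpowr (g x) s \<partial>M)"
    by (rule nn_integral_cmult) measurable
  finally show ?thesis .
qed

section \<open>Muckenhoupt weights\<close>

text \<open>The \<open>A\<^sub>t\<close> condition for \<open>t = 1 + \<tau>\<close>, with the dual weight \<open>\<sigma> = w\<^sup>-\<^sup>1\<^sup>/\<^sup>\<tau>\<close> characterized by the
  relation \<open>w \<sigma>\<^sup>\<tau> = 1\<close>. In this form the hypotheses are symmetric: exchanging \<open>w\<close> and \<open>\<sigma>\<close> replaces \<open>\<tau>\<close> by
  \<open>1 / \<tau>\<close> and \<open>A\<close> by \<open>A\<^sup>1\<^sup>/\<^sup>\<tau>\<close>, so every fact about \<open>w\<close> is also a fact about \<open>\<sigma>\<close>.\<close>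

locale dual_weights =
  fixes w \<sigma> :: "'a::euclidean_space \<Rightarrow> ennreal" and \<tau> A :: real
  assumes \<tau>: "0 < \<tau>" and A: "0 \<le> A"
    and w [measurable]: "w \<in> borel_measurable lebesgue"
    and \<sigma> [measurable]: "\<sigma> \<in> borel_measurable lebesgue"
    and dual: "AE x in lebesgue. w x * ennpowr (\<sigma> x) \<tau> = 1"
    and A_bound: "0 < \<rho> \<Longrightarrow> mean (qcube c \<rho>) w * ennpowr (mean (qcube c \<rho>) \<sigma>) \<tau> \<le> ennreal A"
begin

abbreviation wt :: "('a \<Rightarrow> ennreal) \<Rightarrow> 'a set \<Rightarrow> ennreal" where
  "wt f Q \<equiv> (\<integral>\<^sup>+x\<in>Q. f x \<partial>lebesgue)"

lemma swap: "dual_weights \<sigma> w (1 / \<tau>) (A powr (1 / \<tau>))"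
proof
  show "AE x in lebesgue. \<sigma> x * ennpowr (w x) (1 / \<tau>) = 1"
    using dual
  proof eventually_elim
    case (elim x)
    have "\<sigma> x * ennpowr (w x) (1 / \<tau>) = ennpowr (w x * ennpowr (\<sigma> x) \<tau>) (1 / \<tau>)"
      using \<tau> by (simp add: ennpowr_mult ennpowr_ennpowr mult.commute)
    then show ?case by (simp add: elim)
  qed
next
  fix c \<rho> assume "0 < (\<rho>::real)"
  have "mean (qcube c \<rho>) \<sigma> * ennpowr (mean (qcube c \<rho>) w) (1 / \<tau>)
      = ennpowr (mean (qcube c \<rho>) w * ennpowr (mean (qcube c \<rho>) \<sigma>) \<tau>) (1 / \<tau>)"
    using \<tau> by (simp add: ennpowr_mult ennpowr_ennpowr mult.commute)
  also have "\<dots> \<le> ennpowr (ennreal A) (1 / \<tau>)"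
    using \<tau> by (intro ennpowr_mono A_bound \<open>0 < \<rho>\<close>) auto
  finally show "mean (qcube c \<rho>) \<sigma> * ennpowr (mean (qcube c \<rho>) w) (1 / \<tau>) \<le> ennreal (A powr (1 / \<tau>))"
    using A by (simp add: ennpowr_ennreal)
qed (use \<tau> in auto)

lemma weight_pos_finite: "AE x in lebesgue. 0 < w x \<and> w x < top \<and> 0 < \<sigma> x \<and> \<sigma> x < top"
  using dual
proof eventually_elim
  case (elim x)
  have "w x \<noteq> 0" "\<sigma> x \<noteq> 0" using elim by auto
  moreover have "w x \<noteq> top" "\<sigma> x \<noteq> top"
    using elim \<open>w x \<noteq> 0\<close> \<open>\<sigma> x \<noteq> 0\<close> by auto
  ultimately show ?case by (simp add: zero_less_iff_neq_zero less_top)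
qed

lemma wt_pos:
  assumes "0 < \<rho>"
  shows "wt w (qcube c \<rho>) \<noteq> 0"
proof
  assume "wt w (qcube c \<rho>) = 0"
  then have "AE x in lebesgue. w x * indicator (qcube c \<rho>) x = 0"
    by (subst (asm) nn_integral_0_iff_AE) auto
  with weight_pos_finite have "AE x in lebesgue. x \<notin> qcube c \<rho>"
    by eventually_elim (auto simp: indicator_def split: if_splits)
  then have "emeasure lebesgue (qcube c \<rho>) = 0"
    using AE_iff_measurable[of "qcube c \<rho>" lebesgue "\<lambda>x. x \<notin> qcube c \<rho>"] by simp
  with emeasure_qcube_pos_finite[OF assms] show False by blast
qed

lemma wt_product_le:
  assumes "0 < \<rho>"
  shows "wt w (qcube c \<rho>) * ennpowr (wt \<sigma> (qcube c \<rho>)) \<tau>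
    \<le> ennreal A * ennpowr (emeasure lebesgue (qcube c \<rho>)) (1 + \<tau>)"
proof -
  let ?m = "emeasure lebesgue (qcube c \<rho>)"
  note m = emeasure_qcube_pos_finite[OF assms, of c]
  have eq: "y = y / z * z" if "z \<noteq> 0" "z \<noteq> top" for y z :: ennreal
    using that by (simp add: ennreal_divide_times ennreal_divide_self less_top)
  have "wt w (qcube c \<rho>) * ennpowr (wt \<sigma> (qcube c \<rho>)) \<tau>
      = (wt w (qcube c \<rho>) / ?m * ?m) * (ennpowr (wt \<sigma> (qcube c \<rho>)) \<tau> / ennpowr ?m \<tau> * ennpowr ?m \<tau>)"
    using m by (subst (1 2) eq[symmetric]) auto
  also have "\<dots> = (mean (qcube c \<rho>) w * ennpowr (mean (qcube c \<rho>) \<sigma>) \<tau>) * (?m * ennpowr ?m \<tau>)"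
    using m by (simp add: mean_def ennpowr_divide ac_simps)
  also have "\<dots> \<le> ennreal A * (?m * ennpowr ?m \<tau>)"
    by (intro mult_right_mono A_bound assms) auto
  also have "?m * ennpowr ?m \<tau> = ennpowr ?m (1 + \<tau>)"
    using ennpowr_add[of ?m 1 \<tau>] by simp
  finally show ?thesis .
qed

text \<open>Holder's inequality applied to \<open>1 = (w \<sigma>\<^sup>\<tau>)\<^sup>1\<^sup>/\<^sup>(\<^sup>1\<^sup>+\<^sup>\<tau>\<^sup>)\<close>.\<close>

lemma wt_product_ge:
  assumes "0 < \<rho>"
  shows "ennpowr (emeasure lebesgue (qcube c \<rho>)) (1 + \<tau>)
    \<le> wt w (qcube c \<rho>) * ennpowr (wt \<sigma> (qcube c \<rho>)) \<tau>"
proof -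
  let ?Q = "qcube c \<rho>" and ?\<alpha> = "1 / (1 + \<tau>)"
  have \<alpha>: "0 < ?\<alpha>" "?\<alpha> < 1" "1 - ?\<alpha> = \<tau> * ?\<alpha>" using \<tau> by (auto simp: field_simps)
  have "emeasure lebesgue ?Q = (\<integral>\<^sup>+x. indicator ?Q x \<partial>lebesgue)" by simp
  also have "\<dots> = (\<integral>\<^sup>+x. ennpowr (w x * indicator ?Q x) ?\<alpha> * ennpowr (\<sigma> x * indicator ?Q x) (1 - ?\<alpha>) \<partial>lebesgue)"
    using dual
  proof (intro nn_integral_cong_AE, eventually_elim)
    case (elim x)
    have "ennpowr (w x) ?\<alpha> * ennpowr (\<sigma> x) (1 - ?\<alpha>) = ennpowr (w x * ennpowr (\<sigma> x) \<tau>) ?\<alpha>"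
      by (simp only: \<alpha>(3) ennpowr_mult ennpowr_ennpowr)
    then show ?case by (auto simp: elim indicator_def)
  qed
  also have "\<dots> \<le> ennpowr (wt w ?Q) ?\<alpha> * ennpowr (wt \<sigma> ?Q) (1 - ?\<alpha>)"
    by (intro nn_integral_Holder \<alpha>) auto
  also have "\<dots> = ennpowr (wt w ?Q * ennpowr (wt \<sigma> ?Q) \<tau>) ?\<alpha>"
    by (simp only: \<alpha>(3) ennpowr_mult ennpowr_ennpowr)
  finally have "ennpowr (emeasure lebesgue ?Q) (1 + \<tau>)
      \<le> ennpowr (ennpowr (wt w ?Q * ennpowr (wt \<sigma> ?Q) \<tau>) ?\<alpha>) (1 + \<tau>)"
    using \<tau> by (intro ennpowr_mono) auto
  then show ?thesis using \<tau> by (simp add: ennpowr_ennpowr)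
qed

lemma wt_finite:
  assumes "0 < \<rho>"
  shows "wt w (qcube c \<rho>) \<noteq> top"
proof
  assume top: "wt w (qcube c \<rho>) = top"
  interpret s: dual_weights \<sigma> w "1 / \<tau>" "A powr (1 / \<tau>)" by (rule swap)
  have "wt w (qcube c \<rho>) * ennpowr (wt \<sigma> (qcube c \<rho>)) \<tau> = top"
    using s.wt_pos[OF assms, of c] by (simp add: top ennreal_top_mult)
  moreover have "ennreal A * ennpowr (emeasure lebesgue (qcube c \<rho>)) (1 + \<tau>) \<noteq> top"
    using emeasure_qcube_pos_finite[OF assms, of c] by (simp add: ennreal_mult_eq_top_iff)
  ultimately show False using wt_product_le[OF assms, of c] by (simp add: top_unique)
qed

text \<open>Comparison of the lower bound for \<open>w(Q) \<sigma>(Q)\<^sup>\<tau>\<close> on the small cube, which is Holder's inequality,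
  with the upper bound on the large cube, which is the \<open>A\<^sub>t\<close> condition.\<close>

lemma wt_doubling:
  assumes sub: "qcube c \<rho> \<subseteq> qcube c' \<rho>'" and \<rho>: "0 < \<rho>" "0 < \<rho>'"
  shows "wt w (qcube c' \<rho>') \<le> ennreal (A * ((\<rho>' / \<rho>) ^ DIM('a)) powr (1 + \<tau>)) * wt w (qcube c \<rho>)"
proof -
  let ?Q = "qcube c \<rho>" and ?R = "qcube c' \<rho>'"
  let ?m = "(2 * \<rho>) ^ DIM('a)" and ?n = "(2 * \<rho>') ^ DIM('a)"
  have pos: "0 < ?m" "0 < ?n" using \<rho> by auto
  have "ennreal (?m powr (1 + \<tau>)) * wt w ?R \<le> (wt w ?Q * ennpowr (wt \<sigma> ?Q) \<tau>) * wt w ?R"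
    using wt_product_ge[OF \<rho>(1), of c] \<rho> by (intro mult_right_mono) (auto simp: emeasure_qcube ennpowr_ennreal simp del: power_mult_distrib)
  also have "\<dots> \<le> (wt w ?Q * ennpowr (wt \<sigma> ?R) \<tau>) * wt w ?R"
    using \<tau> sub by (intro mult_right_mono mult_left_mono ennpowr_mono nn_integral_mono)
      (auto simp: indicator_def)
  also have "\<dots> = wt w ?Q * (wt w ?R * ennpowr (wt \<sigma> ?R) \<tau>)" by (simp add: ac_simps)
  also have "\<dots> \<le> wt w ?Q * (ennreal A * ennreal (?n powr (1 + \<tau>)))"
    using wt_product_le[OF \<rho>(2), of c'] \<rho> by (intro mult_left_mono) (auto simp: emeasure_qcube ennpowr_ennreal simp del: power_mult_distrib)
  finally have *: "ennreal (?m powr (1 + \<tau>)) * wt w ?R \<le> wt w ?Q * (ennreal A * ennreal (?n powr (1 + \<tau>)))" .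
  have comb: "ennreal x * (W * (ennreal A * ennreal y)) = ennreal (x * (A * y)) * W"
    if "0 \<le> x" "0 \<le> y" for x y W
    using A that by (simp add: ennreal_mult ac_simps)
  have "wt w ?R = ennreal (1 / ?m powr (1 + \<tau>)) * (ennreal (?m powr (1 + \<tau>)) * wt w ?R)"
    using \<rho> by (simp add: mult.assoc[symmetric] ennreal_mult[symmetric])
  also have "\<dots> \<le> ennreal (1 / ?m powr (1 + \<tau>)) * (wt w ?Q * (ennreal A * ennreal (?n powr (1 + \<tau>))))"
    by (intro mult_left_mono *) auto
  also have "\<dots> = ennreal (1 / ?m powr (1 + \<tau>) * (A * ?n powr (1 + \<tau>))) * wt w ?Q"
    by (rule comb) auto
  also have "1 / ?m powr (1 + \<tau>) * (A * ?n powr (1 + \<tau>)) = A * (?n powr (1 + \<tau>) / ?m powr (1 + \<tau>))"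
    by simp
  also have "?n powr (1 + \<tau>) / ?m powr (1 + \<tau>) = (?n / ?m) powr (1 + \<tau>)"
    by (rule powr_divide[symmetric])
  also have "?n / ?m = (\<rho>' / \<rho>) ^ DIM('a)"
    using \<rho> by (simp add: power_divide[symmetric])
  finally show ?thesis .
qed

text \<open>The ratio 6 also serves the comparison of a cube with one of a sixth of its side length; the
  ratio 3 of the doubling condition is smaller.\<close>

definition doubling_const where "doubling_const = A * (6 ^ DIM('a)) powr (1 + \<tau>)"

lemma doubling_const_nonneg: "0 \<le> doubling_const"
  using A by (simp add: doubling_const_def)

lemma wt_triple:
  assumes "0 < \<rho>"
  shows "wt w (qcube c (3 * \<rho>)) \<le> ennreal doubling_const * wt w (qcube c \<rho>)"
proof -
  have "wt w (qcube c (3 * \<rho>)) \<le> ennreal (A * ((3 * \<rho> / \<rho>) ^ DIM('a)) powr (1 + \<tau>)) * wt w (qcube c \<rho>)"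
    using assms by (intro wt_doubling qcube_mono) auto
  also have "\<dots> \<le> ennreal doubling_const * wt w (qcube c \<rho>)"
    unfolding doubling_const_def using A assms \<tau>
    by (intro mult_right_mono ennreal_leI mult_left_mono powr_mono2 power_mono) auto
  finally show ?thesis .
qed

text \<open>A cube \<open>S\<close> of one sixth of the side length of \<open>3Q\<close> fits into \<open>3Q - Q\<close>, and doubling gives it a
  fixed proportion of the weight of \<open>3Q\<close>. Hence \<open>Q\<close> has at most the remaining proportion, and iteration
  yields geometric decay. Applied to \<open>\<sigma>\<close>, this is where the decay over the annuli comes from.\<close>

lemma wt_reverse_doubling:
  obtains \<theta> where "0 < \<theta>" "\<theta> < 1"
    "\<And>k c \<rho>. 0 < \<rho> \<Longrightarrow> wt w (qcube c \<rho>) \<le> ennreal (\<theta> ^ k) * wt w (qcube c (3 ^ k * \<rho>))"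
proof -
  have step: "wt w (qcube c \<rho>) \<le> ennreal (1 - 1 / (2 * doubling_const)) * wt w (qcube c (3 * \<rho>)) \<and> 1 \<le> doubling_const"
    if \<rho>: "0 < \<rho>" for c \<rho>
  proof -
    obtain b :: 'a where b: "b \<in> Basis" using nonempty_Basis by blast
    \<comment> \<open>In the direction \<open>b\<close> the new cube occupies the interval from \<open>2 * \<rho>\<close> to \<open>3 * \<rho>\<close>.\<close>
    define c' where "c' = c + (5 / 2 * \<rho>) *\<^sub>R b"
    let ?Q = "qcube c \<rho>" and ?R = "qcube c (3 * \<rho>)" and ?S = "qcube c' (\<rho> / 2)"
    have c': "c' \<bullet> i = c \<bullet> i + (if i = b then 5 / 2 * \<rho> else 0)" if "i \<in> Basis" for i
      using that b by (simp add: c'_def inner_add_left inner_Basis)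
    have SR: "?S \<subseteq> ?R"
    proof
      fix x assume x: "x \<in> ?S"
      show "x \<in> ?R"
        unfolding mem_qcube
      proof
        fix i :: 'a assume i: "i \<in> Basis"
        with x have *: "\<bar>x \<bullet> i - c' \<bullet> i\<bar> \<le> \<rho> / 2" by (simp add: mem_qcube)
        have "c' \<bullet> i = c \<bullet> i + 5 / 2 * \<rho> \<or> c' \<bullet> i = c \<bullet> i" using c'[OF i] by simp
        then show "\<bar>x \<bullet> i - c \<bullet> i\<bar> \<le> 3 * \<rho>" using * \<rho> by (elim disjE) linarith+
      qed
    qed
    have disj: "?Q \<inter> ?S = {}"
    proof -
      have False if "x \<in> ?Q" "x \<in> ?S" for x
      proof -
        have "\<bar>x \<bullet> b - c' \<bullet> b\<bar> \<le> \<rho> / 2" "\<bar>x \<bullet> b - c \<bullet> b\<bar> \<le> \<rho>"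
          using that b by (auto simp: mem_qcube)
        then show False using c'[OF b] \<rho> by simp
      qed
      then show ?thesis by blast
    qed
    have QR: "?Q \<subseteq> ?R" using \<rho> by (intro qcube_mono) auto
    have 1: "wt w ?Q + wt w ?S \<le> wt w ?R"
    proof -
      have "wt w ?Q + wt w ?S = (\<integral>\<^sup>+x. w x * indicator ?Q x + w x * indicator ?S x \<partial>lebesgue)"
        by (rule nn_integral_add[symmetric]) auto
      also have "\<dots> \<le> wt w ?R"
        using disj QR SR by (intro nn_integral_mono) (auto simp: indicator_def)
      finally show ?thesis .
    qed
    have 2: "wt w ?R \<le> ennreal doubling_const * wt w ?S"
      using wt_doubling[OF SR] \<rho> by (simp add: doubling_const_def)
    obtain x where x: "wt w ?Q = ennreal x" "0 < x"
      using wt_pos[OF \<rho>, of c] wt_finite[OF \<rho>, of c]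
      by (cases "wt w ?Q") (auto simp: ennreal_eq_0_iff not_le)
    obtain y where y: "wt w ?R = ennreal y" "0 < y"
      using wt_pos[of "3 * \<rho>" c] wt_finite[of "3 * \<rho>" c] \<rho>
      by (cases "wt w ?R") (auto simp: ennreal_eq_0_iff not_le)
    obtain z where z: "wt w ?S = ennreal z" "0 < z"
      using wt_pos[of "\<rho> / 2" c'] wt_finite[of "\<rho> / 2" c'] \<rho>
      by (cases "wt w ?S") (auto simp: ennreal_eq_0_iff not_le)
    have xyz: "x + z \<le> y" "y \<le> doubling_const * z"
      using 1 2 x y z doubling_const_nonneg
      by (auto simp: ennreal_plus[symmetric] ennreal_mult[symmetric] ennreal_le_iff simp del: ennreal_plus)
    have D1: "1 \<le> doubling_const"
    proof (rule ccontr)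
      assume "\<not> 1 \<le> doubling_const"
      then have "doubling_const * z \<le> 1 * z" using z by (intro mult_right_mono) auto
      with xyz x show False by simp
    qed
    then have "y / (2 * doubling_const) \<le> y / doubling_const" "y / doubling_const \<le> z" using xyz y by (auto simp: field_simps)
    then have "x \<le> (1 - 1 / (2 * doubling_const)) * y" using xyz by (simp add: algebra_simps)
    then show ?thesis
      using D1 x y by (simp add: ennreal_mult'[symmetric] ennreal_leI)
  qed
  have D1: "1 \<le> doubling_const" using step[of 1 0] by simp
  show ?thesis
  \<comment> \<open>The factor 2 keeps the ratio positive when the doubling constant is 1.\<close>
  proof (rule that[of "1 - 1 / (2 * doubling_const)"])
    show "wt w (qcube c \<rho>) \<le> ennreal ((1 - 1 / (2 * doubling_const)) ^ k) * wt w (qcube c (3 ^ k * \<rho>))"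
      if "0 < \<rho>" for k c \<rho>
    proof (induction k)
      case (Suc k)
      have "wt w (qcube c (3 ^ k * \<rho>)) \<le> ennreal (1 - 1 / (2 * doubling_const)) * wt w (qcube c (3 * (3 ^ k * \<rho>)))"
        using step[of "3 ^ k * \<rho>" c] that by simp
      then have "ennreal ((1 - 1 / (2 * doubling_const)) ^ k) * wt w (qcube c (3 ^ k * \<rho>))
          \<le> ennreal ((1 - 1 / (2 * doubling_const)) ^ k) * (ennreal (1 - 1 / (2 * doubling_const)) * wt w (qcube c (3 * (3 ^ k * \<rho>))))"
        by (rule mult_left_mono) auto
      with Suc show ?case
        using D1 by (simp add: mult.assoc[symmetric] ennreal_mult[symmetric] mult.commute)
    qed simp
  qed (use D1 in \<open>auto simp: field_simps\<close>)
qed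

lemma density_cube: "emeasure (density lebesgue w) (qcube c \<rho>) = wt w (qcube c \<rho>)"
  by (simp add: emeasure_density)

lemma sigma_finite_weight: "sigma_finite_measure (density lebesgue w)"
proof
  show "\<exists>B. countable B \<and> B \<subseteq> sets (density lebesgue w) \<and> \<Union> B = space (density lebesgue w)
      \<and> (\<forall>a\<in>B. emeasure (density lebesgue w) a \<noteq> \<infinity>)"
  proof (intro exI conjI)
    let ?B = "range (\<lambda>n::nat. qcube (0::'a) (real (Suc n)))"
    show "\<Union> ?B = space (density lebesgue w)" using qcube_exhaust by auto
    show "\<forall>a\<in>?B. emeasure (density lebesgue w) a \<noteq> \<infinity>"
      using wt_finite by (auto simp: density_cube)
  qed auto
qed

lemma weighted_strong_type:
  assumes "countable \<D>" "\<And>c \<rho>. (c, \<rho>) \<in> \<D> \<Longrightarrow> 0 < \<rho>"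
    and "g \<in> borel_measurable lebesgue" and "1 < s"
  shows "(\<integral>\<^sup>+x. w x * ennpowr (maxop \<D> (density lebesgue w) g x) s \<partial>lebesgue)
    \<le> ennreal (doubling_const * (s / (s - 1)) * 2 powr s) * (\<integral>\<^sup>+x. w x * ennpowr (g x) s \<partial>lebesgue)"
proof -
  have [measurable]: "maxop \<D> (density lebesgue w) g \<in> borel_measurable lebesgue"
    using measurable_maxop[OF assms(1), of "density lebesgue w" g] by simp
  show ?thesis
    using maxop_strong_type[OF assms(1) _ sigma_finite_weight doubling_const_nonneg, of g s] assms
    by (simp add: density_cube wt_triple nn_integral_density)
qed

text \<open>Holder's inequality for \<open>F = (w F\<^sup>u)\<^sup>1\<^sup>/\<^sup>u \<sigma>\<^sup>\<tau>\<^sup>/\<^sup>u\<close>. If \<open>u\<close> is larger than \<open>1 + \<tau>\<close>, the exponents of the two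
  factors do not add up to 1, and the constant 1 takes up the rest; it contributes the power
  \<open>u - 1 - \<tau>\<close> of the volume.\<close>

lemma nn_integral_le_dual:
  assumes u: "1 + \<tau> \<le> u" and \<rho>: "0 < \<rho>"
    and F [measurable]: "F \<in> borel_measurable lebesgue"
  shows "ennpowr (wt F (qcube c \<rho>)) u
    \<le> wt (\<lambda>x. w x * ennpowr (F x) u) (qcube c \<rho>)
      * ennpowr (emeasure lebesgue (qcube c \<rho>)) (u - 1 - \<tau>) * ennpowr (wt \<sigma> (qcube c \<rho>)) \<tau>"
proof -
  let ?Q = "qcube c \<rho>" and ?\<beta> = "\<tau> / (u - 1)"
  let ?\<sigma>' = "\<lambda>x. ennpowr (\<sigma> x) ?\<beta>"
  have u1: "1 < u" using u \<tau> by simp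
  then have \<alpha>: "0 < 1 / u" "1 / u < 1" "1 - 1 / u = (u - 1) / u" by (auto simp: field_simps)
  have \<beta>: "0 < ?\<beta>" "?\<beta> \<le> 1" using u \<tau> by auto
  have "wt F ?Q = (\<integral>\<^sup>+x. ennpowr (w x * ennpowr (F x) u * indicator ?Q x) (1 / u)
      * ennpowr (?\<sigma>' x * indicator ?Q x) (1 - 1 / u) \<partial>lebesgue)"
  proof (rule nn_integral_cong_AE)
    show "AE x in lebesgue. F x * indicator ?Q x
        = ennpowr (w x * ennpowr (F x) u * indicator ?Q x) (1 / u)
          * ennpowr (?\<sigma>' x * indicator ?Q x) (1 - 1 / u)"
      using dual
    proof eventually_elim
      case (elim x)
      have "?\<beta> * (1 - 1 / u) = \<tau> * (1 / u)" unfolding \<alpha>(3) using u1 by (simp add: field_simps)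
      then have "ennpowr (?\<sigma>' x) (1 - 1 / u) = ennpowr (ennpowr (\<sigma> x) \<tau>) (1 / u)"
        by (simp only: ennpowr_ennpowr)
      then have "ennpowr (w x * ennpowr (F x) u) (1 / u) * ennpowr (?\<sigma>' x) (1 - 1 / u)
          = ennpowr (ennpowr (F x) u) (1 / u) * ennpowr (w x * ennpowr (\<sigma> x) \<tau>) (1 / u)"
        by (simp only: ennpowr_mult ac_simps)
      also have "\<dots> = F x" using u1 by (simp add: elim ennpowr_ennpowr)
      finally show ?case by (auto simp: indicator_def)
    qed
  qed
  also have "\<dots> \<le> ennpowr (wt (\<lambda>x. w x * ennpowr (F x) u) ?Q) (1 / u) * ennpowr (wt ?\<sigma>' ?Q) (1 - 1 / u)"
    by (intro nn_integral_Holder \<alpha>) auto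
  finally have "ennpowr (wt F ?Q) u
      \<le> ennpowr (ennpowr (wt (\<lambda>x. w x * ennpowr (F x) u) ?Q) (1 / u) * ennpowr (wt ?\<sigma>' ?Q) (1 - 1 / u)) u"
    using u1 by (intro ennpowr_mono) auto
  also have "\<dots> = wt (\<lambda>x. w x * ennpowr (F x) u) ?Q * ennpowr (wt ?\<sigma>' ?Q) (u - 1)"
    unfolding \<alpha>(3) using u1 by (simp add: ennpowr_mult ennpowr_ennpowr)
  also have "ennpowr (wt ?\<sigma>' ?Q) (u - 1)
      \<le> ennpowr (ennpowr (wt \<sigma> ?Q) ?\<beta> * ennpowr (emeasure lebesgue ?Q) (1 - ?\<beta>)) (u - 1)"
  proof (rule ennpowr_mono)
    show "wt ?\<sigma>' ?Q \<le> ennpowr (wt \<sigma> ?Q) ?\<beta> * ennpowr (emeasure lebesgue ?Q) (1 - ?\<beta>)"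
      by (intro nn_integral_ennpowr_le \<beta> emeasure_qcube_pos_finite \<rho>) auto
  qed (use u1 in auto)
  also have "\<dots> = ennpowr (emeasure lebesgue ?Q) (u - 1 - \<tau>) * ennpowr (wt \<sigma> ?Q) \<tau>"
  proof -
    have "?\<beta> * (u - 1) = \<tau>" "(1 - ?\<beta>) * (u - 1) = u - 1 - \<tau>" using u1 by (auto simp: field_simps)
    then show ?thesis by (simp only: ennpowr_mult ennpowr_ennpowr mult.commute)
  qed
  finally show ?thesis by (simp add: mult_left_mono mult.assoc)
qed

text \<open>The classes \<open>A\<^sub>t\<close> increase with \<open>t\<close>, by Jensen's inequality for the dual weights.\<close>

lemma dual_weights_mono:
  assumes "\<tau> \<le> \<tau>'"
  shows "dual_weights w (\<lambda>x. ennpowr (\<sigma> x) (\<tau> / \<tau>')) \<tau>' A"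
proof
  have \<tau>': "0 < \<tau>'" using \<tau> assms by simp
  then show "0 < \<tau>'" "0 \<le> A" using A by auto
  show "AE x in lebesgue. w x * ennpowr (ennpowr (\<sigma> x) (\<tau> / \<tau>')) \<tau>' = 1"
    using dual \<tau>' by (simp add: ennpowr_ennpowr)
  fix c :: 'a and \<rho> :: real assume \<rho>: "0 < \<rho>"
  let ?Q = "qcube c \<rho>" and ?\<beta> = "\<tau> / \<tau>'"
  note m = emeasure_qcube_pos_finite[OF \<rho>, of c]
  have \<beta>: "0 < ?\<beta>" "?\<beta> \<le> 1" using assms \<tau> by auto
  have "mean ?Q (\<lambda>x. ennpowr (\<sigma> x) ?\<beta>) \<le> ennpowr (mean ?Q \<sigma>) ?\<beta>"
  proof -
    have *: "wt (\<lambda>x. ennpowr (\<sigma> x) ?\<beta>) ?Q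
        \<le> ennpowr (wt \<sigma> ?Q) ?\<beta> * ennpowr (emeasure lebesgue ?Q) (1 - ?\<beta>)"
      by (intro nn_integral_ennpowr_le \<beta> m) auto
    obtain a where a: "emeasure lebesgue ?Q = ennreal a" "0 < a"
      using m by (cases "emeasure lebesgue ?Q") (auto simp: ennreal_eq_0_iff not_le)
    have "mean ?Q (\<lambda>x. ennpowr (\<sigma> x) ?\<beta>)
        \<le> ennpowr (wt \<sigma> ?Q) ?\<beta> * ennpowr (emeasure lebesgue ?Q) (1 - ?\<beta>) / emeasure lebesgue ?Q"
      unfolding mean_def by (intro divide_right_mono_ennreal *)
    also have "\<dots> = ennpowr (wt \<sigma> ?Q) ?\<beta> * (ennpowr (ennreal a) (1 - ?\<beta>) / ennreal a)"
      by (simp only: a ennreal_times_divide)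
    also have "ennpowr (ennreal a) (1 - ?\<beta>) / ennreal a = 1 / ennpowr (ennreal a) ?\<beta>"
      using a by (simp add: ennpowr_ennreal divide_ennreal powr_diff ennreal_1[symmetric] del: ennreal_1)
    also have "ennpowr (wt \<sigma> ?Q) ?\<beta> * (1 / ennpowr (ennreal a) ?\<beta>) = ennpowr (mean ?Q \<sigma>) ?\<beta>"
      using m by (simp add: a mean_def ennpowr_divide ennreal_times_divide)
    finally show ?thesis .
  qed
  then have "ennpowr (mean ?Q (\<lambda>x. ennpowr (\<sigma> x) ?\<beta>)) \<tau>' \<le> ennpowr (ennpowr (mean ?Q \<sigma>) ?\<beta>) \<tau>'"
    using \<tau>' by (intro ennpowr_mono) auto
  then have "mean ?Q w * ennpowr (mean ?Q (\<lambda>x. ennpowr (\<sigma> x) ?\<beta>)) \<tau>'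
      \<le> mean ?Q w * ennpowr (mean ?Q \<sigma>) \<tau>"
    using \<tau>' by (intro mult_left_mono) (auto simp: ennpowr_ennpowr)
  also have "\<dots> \<le> ennreal A" by (rule A_bound[OF \<rho>])
  finally show "mean ?Q w * ennpowr (mean ?Q (\<lambda>x. ennpowr (\<sigma> x) ?\<beta>)) \<tau>' \<le> ennreal A" .
qed auto

text \<open>Lerner's argument. Write \<open>I\<close>, \<open>m\<close>, \<open>S\<close>, \<open>W\<close> for the integral of \<open>F\<close>, the volume and the two weights of a
  cube \<open>Q\<close> that contains \<open>x\<close>. The \<open>A\<^sub>t\<close> condition bounds \<open>(I/m)\<^sup>\<tau> = (I/S)\<^sup>\<tau> (S/m)\<^sup>\<tau>\<close> by \<open>A (I/S)\<^sup>\<tau> m / W\<close>.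
  Here \<open>I/S\<close> is the average of \<open>F/\<sigma>\<close> for the measure \<open>\<sigma>\<close>, so it is at most \<open>G\<close> on all of \<open>Q\<close>, and
  \<open>(I/S)\<^sup>\<tau> m\<close> is at most the integral of \<open>G\<^sup>\<tau>\<close> over \<open>Q\<close>. Divided by \<open>W\<close>, that integral is an average of
  \<open>G\<^sup>\<tau>/w\<close> for the measure \<open>w\<close>.\<close>

lemma maxop_le_weighted_maxop:
  assumes \<D>: "countable \<D>" "\<And>c \<rho>. (c, \<rho>) \<in> \<D> \<Longrightarrow> 0 < \<rho>"
    and F [measurable]: "F \<in> borel_measurable lebesgue"
  defines "G \<equiv> maxop \<D> (density lebesgue \<sigma>) (\<lambda>y. F y / \<sigma> y)"
  shows "maxop \<D> lebesgue F x
    \<le> ennpowr (ennreal A * maxop \<D> (density lebesgue w) (\<lambda>y. ennpowr (G y) \<tau> / w y) x) (1 / \<tau>)"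
  unfolding maxop_def[of \<D> lebesgue]
proof (rule SUP_least, clarify)
  fix c \<rho> assume c: "(c, \<rho>) \<in> \<D>"
  then have \<rho>: "0 < \<rho>" using \<D> by auto
  interpret s: dual_weights \<sigma> w "1 / \<tau>" "A powr (1 / \<tau>)" by (rule swap)
  have [measurable]: "G \<in> borel_measurable lebesgue"
    using measurable_maxop[OF \<D>(1), of "density lebesgue \<sigma>"] by (simp add: G_def)
  let ?Q = "qcube c \<rho>"
  let ?I = "wt F ?Q" and ?m = "emeasure lebesgue ?Q"
  let ?S = "wt \<sigma> ?Q" and ?W = "wt w ?Q"
  note m = emeasure_qcube_pos_finite[OF \<rho>, of c]
  have S: "?S \<noteq> 0" "?S \<noteq> top" using s.wt_pos[OF \<rho>] s.wt_finite[OF \<rho>] by auto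
  have W: "?W \<noteq> 0" "?W \<noteq> top" using wt_pos[OF \<rho>] wt_finite[OF \<rho>] by auto
  have eq: "z * (y / z) = y" if "z \<noteq> 0" "z \<noteq> top" for y z :: ennreal
    using that by (simp add: ennreal_times_divide ennreal_mult_divide_eq mult.commute)
  have eq': "z * (y / z) = y" if "0 < z" "z < top" for y z :: ennreal
    using that by (intro eq) auto
  have dens\<sigma>: "(\<integral>\<^sup>+y\<in>?Q. F y / \<sigma> y \<partial>density lebesgue \<sigma>) = ?I"
    using weight_pos_finite
    by (subst nn_integral_density, measurable)
      (intro nn_integral_cong_AE, erule eventually_mono, simp add: mult.assoc[symmetric] eq')
  have densw: "(\<integral>\<^sup>+y\<in>?Q. ennpowr (G y) \<tau> / w y \<partial>density lebesgue w) = (\<integral>\<^sup>+y\<in>?Q. ennpowr (G y) \<tau> \<partial>lebesgue)"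
    using weight_pos_finite
    by (subst nn_integral_density, measurable)
      (intro nn_integral_cong_AE, erule eventually_mono, simp add: mult.assoc[symmetric] eq')
  have G: "?I / ?S \<le> G y" if "y \<in> ?Q" for y
    using average_le_maxop[OF c that, of "density lebesgue \<sigma>" "\<lambda>y. F y / \<sigma> y"]
    by (simp add: G_def dens\<sigma> s.density_cube)
  show "?I / ?m * indicator ?Q x
      \<le> ennpowr (ennreal A * maxop \<D> (density lebesgue w) (\<lambda>y. ennpowr (G y) \<tau> / w y) x) (1 / \<tau>)"
  proof (cases "x \<in> ?Q")
    case True
    have "ennpowr (?I / ?S) \<tau> * ?m = (\<integral>\<^sup>+y\<in>?Q. ennpowr (?I / ?S) \<tau> \<partial>lebesgue)"
      by (simp add: nn_integral_cmult_indicator)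
    also have "\<dots> \<le> (\<integral>\<^sup>+y\<in>?Q. ennpowr (G y) \<tau> \<partial>lebesgue)"
      using \<tau> G by (intro nn_integral_mono) (auto simp: indicator_def ennpowr_mono)
    also have "\<dots> = (\<integral>\<^sup>+y\<in>?Q. ennpowr (G y) \<tau> / w y \<partial>density lebesgue w)"
      by (rule densw[symmetric])
    finally have "ennpowr (?I / ?S) \<tau> * ?m / ?W
        \<le> (\<integral>\<^sup>+y\<in>?Q. ennpowr (G y) \<tau> / w y \<partial>density lebesgue w) / emeasure (density lebesgue w) ?Q"
      by (simp add: density_cube divide_right_mono_ennreal)
    also have "\<dots> \<le> maxop \<D> (density lebesgue w) (\<lambda>y. ennpowr (G y) \<tau> / w y) x"
      by (rule average_le_maxop[OF c True])
    finally have 1: "ennpowr (?I / ?S) \<tau> * ?m / ?W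
      \<le> maxop \<D> (density lebesgue w) (\<lambda>y. ennpowr (G y) \<tau> / w y) x" .
    have "?I / ?S * ?S = ?I" using eq[OF S] by (simp only: mult.commute)
    then have "?I / ?m = (?I / ?S) * (?S / ?m)" by (simp only: ennreal_times_divide)
    then have "ennpowr (?I / ?m) \<tau> = ennpowr (?I / ?S) \<tau> * ennpowr (mean ?Q \<sigma>) \<tau>"
      by (simp add: ennpowr_mult mean_def)
    also have "ennpowr (mean ?Q \<sigma>) \<tau> = (mean ?Q w * ennpowr (mean ?Q \<sigma>) \<tau>) / mean ?Q w"
      using W m by (subst mult.commute, subst ennreal_mult_divide_eq)
        (auto simp: mean_def ennreal_divide_eq_top_iff)
    also have "ennpowr (?I / ?S) \<tau> * \<dots> \<le> ennpowr (?I / ?S) \<tau> * (ennreal A / mean ?Q w)"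
      by (intro mult_left_mono divide_right_mono_ennreal A_bound \<rho>) auto
    also have "ennreal A / mean ?Q w = ennreal A * (?m / ?W)"
    proof -
      obtain a where a: "?m = ennreal a" "0 < a"
        using m by (cases ?m) (auto simp: ennreal_eq_0_iff not_le)
      obtain b where b: "?W = ennreal b" "0 < b"
        using W by (cases ?W) (auto simp: ennreal_eq_0_iff not_le)
      show ?thesis
        using a b A by (simp add: mean_def divide_ennreal ennreal_mult[symmetric])
    qed
    also have "ennpowr (?I / ?S) \<tau> * (ennreal A * (?m / ?W)) = ennreal A * (ennpowr (?I / ?S) \<tau> * ?m / ?W)"
      by (simp only: ennreal_times_divide mult.left_commute)
    also have "\<dots> \<le> ennreal A * maxop \<D> (density lebesgue w) (\<lambda>y. ennpowr (G y) \<tau> / w y) x"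
      by (intro mult_left_mono 1) auto
    finally have "ennpowr (ennpowr (?I / ?m) \<tau>) (1 / \<tau>)
        \<le> ennpowr (ennreal A * maxop \<D> (density lebesgue w) (\<lambda>y. ennpowr (G y) \<tau> / w y) x) (1 / \<tau>)"
      using \<tau> by (intro ennpowr_mono) auto
    then show ?thesis using True \<tau> by (simp add: ennpowr_ennpowr)
  qed auto
qed

text \<open>Both maximal operators in Lerner's bound belong to doubling measures. The operator for \<open>w\<close> is
  bounded on \<open>L\<^sup>t(w)\<close> with \<open>t = (1 + \<tau>)/\<tau>\<close>, the one for \<open>\<sigma>\<close> on \<open>L\<^sup>u(\<sigma>)\<close> with \<open>u = 1 + \<tau>\<close>, and the weights match
  because \<open>(G\<^sup>\<tau>/w)\<^sup>t w = G\<^sup>u \<sigma>\<close> and \<open>(F/\<sigma>)\<^sup>u \<sigma> = F\<^sup>u w\<close>.\<close>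

theorem Muckenhoupt:
  assumes \<D>: "countable \<D>" "\<And>c \<rho>. (c, \<rho>) \<in> \<D> \<Longrightarrow> 0 < \<rho>"
  shows "\<exists>C\<ge>0. \<forall>F\<in>borel_measurable lebesgue.
      (\<integral>\<^sup>+x. w x * ennpowr (maxop \<D> lebesgue F x) (1 + \<tau>) \<partial>lebesgue)
        \<le> ennreal C * (\<integral>\<^sup>+x. w x * ennpowr (F x) (1 + \<tau>) \<partial>lebesgue)"
proof -
  interpret s: dual_weights \<sigma> w "1 / \<tau>" "A powr (1 / \<tau>)" by (rule swap)
  let ?u = "1 + \<tau>" and ?t = "(1 + \<tau>) / \<tau>"
  have u: "1 < ?u" "1 < ?t" using \<tau> by (auto simp: field_simps)
  define C1 where "C1 = doubling_const * (?t / (?t - 1)) * 2 powr ?t"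
  define C2 where "C2 = s.doubling_const * (?u / (?u - 1)) * 2 powr ?u"
  have C: "0 \<le> C1" "0 \<le> C2"
    using doubling_const_nonneg s.doubling_const_nonneg u by (auto simp: C1_def C2_def)
  show ?thesis
  proof (intro exI[of _ "A powr ?t * (C1 * C2)"] conjI ballI)
    show "0 \<le> A powr ?t * (C1 * C2)" using C by simp
    fix F :: "'a \<Rightarrow> ennreal"
    assume F [measurable]: "F \<in> borel_measurable lebesgue"
    define G where "G = maxop \<D> (density lebesgue \<sigma>) (\<lambda>y. F y / \<sigma> y)"
    define H where "H = maxop \<D> (density lebesgue w) (\<lambda>y. ennpowr (G y) \<tau> / w y)"
    have [measurable]: "G \<in> borel_measurable lebesgue"
      using measurable_maxop[OF \<D>(1), of "density lebesgue \<sigma>"] by (simp add: G_def)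
    have [measurable]: "H \<in> borel_measurable lebesgue"
      using measurable_maxop[OF \<D>(1), of "density lebesgue w"] by (simp add: H_def)
    have "(\<integral>\<^sup>+x. w x * ennpowr (maxop \<D> lebesgue F x) ?u \<partial>lebesgue)
        \<le> (\<integral>\<^sup>+x. w x * (ennreal (A powr ?t) * ennpowr (H x) ?t) \<partial>lebesgue)"
    proof (intro nn_integral_mono mult_left_mono)
      fix x
      have "ennpowr (maxop \<D> lebesgue F x) ?u \<le> ennpowr (ennpowr (ennreal A * H x) (1 / \<tau>)) ?u"
        unfolding H_def G_def using \<tau> by (intro ennpowr_mono maxop_le_weighted_maxop \<D> F) auto
      then show "ennpowr (maxop \<D> lebesgue F x) ?u \<le> ennreal (A powr ?t) * ennpowr (H x) ?t"
        using A by (simp add: ennpowr_ennpowr ennpowr_mult ennpowr_ennreal powr_powr)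
    qed auto
    also have "\<dots> = ennreal (A powr ?t) * (\<integral>\<^sup>+x. w x * ennpowr (H x) ?t \<partial>lebesgue)"
      by (subst nn_integral_cmult[symmetric]) (auto simp: mult.left_commute)
    also have "\<dots> \<le> ennreal (A powr ?t) * (ennreal C1 * (\<integral>\<^sup>+x. w x * ennpowr (ennpowr (G x) \<tau> / w x) ?t \<partial>lebesgue))"
      unfolding H_def C1_def
      by (intro mult_left_mono weighted_strong_type \<D> u) auto
    also have "(\<integral>\<^sup>+x. w x * ennpowr (ennpowr (G x) \<tau> / w x) ?t \<partial>lebesgue)
        = (\<integral>\<^sup>+x. \<sigma> x * ennpowr (G x) ?u \<partial>lebesgue)"
    proof (rule nn_integral_cong_AE)
      show "AE x in lebesgue. w x * ennpowr (ennpowr (G x) \<tau> / w x) ?t = \<sigma> x * ennpowr (G x) ?u"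
        using weight_pos_finite s.dual
      proof eventually_elim
        case (elim x)
        have t: "?t = 1 + 1 / \<tau>" using \<tau> by (simp add: field_simps)
        have w: "w x \<noteq> 0" "w x \<noteq> top" using elim by auto
        have "\<sigma> x = \<sigma> x * (w x * ennpowr (w x) (1 / \<tau>)) / ennpowr (w x) ?t"
          using w ennpowr_add[of "w x" 1 "1 / \<tau>"] by (simp add: t ennreal_mult_divide_eq)
        also have "\<sigma> x * (w x * ennpowr (w x) (1 / \<tau>)) = w x"
          using elim(2) by (subst mult.left_commute) simp
        finally have "\<sigma> x = w x / ennpowr (w x) ?t" .
        moreover have "ennpowr (ennpowr (G x) \<tau> / w x) ?t = ennpowr (G x) ?u / ennpowr (w x) ?t"
          using w \<tau> by (simp add: ennpowr_divide ennpowr_ennpowr)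
        ultimately show ?case by (simp add: ennreal_times_divide ennreal_divide_times mult.commute)
      qed
    qed
    also have "ennreal (A powr ?t) * (ennreal C1 * (\<integral>\<^sup>+x. \<sigma> x * ennpowr (G x) ?u \<partial>lebesgue))
      \<le> ennreal (A powr ?t) * (ennreal C1 * (ennreal C2 * (\<integral>\<^sup>+x. \<sigma> x * ennpowr (F x / \<sigma> x) ?u \<partial>lebesgue)))"
      unfolding G_def C2_def
      by (intro mult_left_mono s.weighted_strong_type \<D> u) auto
    also have "(\<integral>\<^sup>+x. \<sigma> x * ennpowr (F x / \<sigma> x) ?u \<partial>lebesgue) = (\<integral>\<^sup>+x. w x * ennpowr (F x) ?u \<partial>lebesgue)"
    proof (rule nn_integral_cong_AE)
      show "AE x in lebesgue. \<sigma> x * ennpowr (F x / \<sigma> x) ?u = w x * ennpowr (F x) ?u"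
        using weight_pos_finite dual
      proof eventually_elim
        case (elim x)
        have s: "\<sigma> x \<noteq> 0" "\<sigma> x \<noteq> top" using elim by auto
        have "w x = w x * (\<sigma> x * ennpowr (\<sigma> x) \<tau>) / ennpowr (\<sigma> x) ?u"
          using s ennpowr_add[of "\<sigma> x" 1 \<tau>] by (simp add: ennreal_mult_divide_eq)
        also have "w x * (\<sigma> x * ennpowr (\<sigma> x) \<tau>) = \<sigma> x"
          using elim(2) by (subst mult.left_commute) simp
        finally have "w x = \<sigma> x / ennpowr (\<sigma> x) ?u" .
        moreover have "ennpowr (F x / \<sigma> x) ?u = ennpowr (F x) ?u / ennpowr (\<sigma> x) ?u"
          using s by (simp add: ennpowr_divide)
        ultimately show ?case by (simp add: ennreal_times_divide ennreal_divide_times mult.commute)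
      qed
    qed
    finally show "(\<integral>\<^sup>+x. w x * ennpowr (maxop \<D> lebesgue F x) ?u \<partial>lebesgue)
        \<le> ennreal (A powr ?t * (C1 * C2)) * (\<integral>\<^sup>+x. w x * ennpowr (F x) ?u \<partial>lebesgue)"
      using C by (simp add: ennreal_mult mult.assoc)
  qed
qed

end

section \<open>The maximal operator\<close>

text \<open>The cubes of the family that contain \<open>Q\<close> can be chosen with volumes tending to that of \<open>Q\<close>, and
  the integral of \<open>F\<close> over them is at least the integral over \<open>Q\<close>.\<close>

lemma mean_le_maxop:
  fixes \<D> :: "('a::euclidean_space \<times> real) set"
  assumes dense: "\<And>c \<rho> \<epsilon>. 0 < \<rho> \<Longrightarrow> 0 < \<epsilon> \<Longrightarrow>
      \<exists>c' \<rho>'. (c', \<rho>') \<in> \<D> \<and> qcube c \<rho> \<subseteq> qcube c' \<rho>' \<and> \<rho>' \<le> \<rho> + \<epsilon>"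
    and pos: "\<And>c \<rho>. (c, \<rho>) \<in> \<D> \<Longrightarrow> 0 < \<rho>"
    and \<rho>: "0 < \<rho>" and x: "x \<in> qcube c \<rho>"
  shows "mean (qcube c \<rho>) F \<le> maxop \<D> lebesgue F x"
proof -
  let ?Q = "qcube c \<rho>" and ?d = "DIM('a)"
  let ?I = "\<integral>\<^sup>+x\<in>?Q. F x \<partial>lebesgue"
  define s where "s n = \<rho> + 1 / real (Suc n)" for n
  have s: "\<rho> < s n" for n by (simp add: s_def)
  define e where "e n = (\<rho> / s n) ^ ?d" for n
  have bound: "mean ?Q F * ennreal (e n) \<le> maxop \<D> lebesgue F x" for n
  proof -
    have "0 < 1 / real (Suc n)" by simp
    from dense[OF \<rho> this] obtain c' \<rho>'
      where c': "(c', \<rho>') \<in> \<D>" "?Q \<subseteq> qcube c' \<rho>'" "\<rho>' \<le> s n" unfolding s_def by blast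
    have \<rho>': "0 < \<rho>'" using pos c' by blast
    have "mean ?Q F * ennreal (e n) = ?I * (ennreal (e n) / ennreal ((2 * \<rho>) ^ ?d))"
      using \<rho> by (simp add: mean_def emeasure_qcube ennreal_times_divide ennreal_divide_times)
    also have "ennreal (e n) / ennreal ((2 * \<rho>) ^ ?d) = ennreal (1 / (2 * s n) ^ ?d)"
      using \<rho> s[of n] by (subst divide_ennreal) (auto simp: e_def power_divide power_mult_distrib)
    also have "\<dots> \<le> ennreal (1 / (2 * \<rho>') ^ ?d)"
      using c'(3) \<rho>' by (intro ennreal_leI divide_left_mono power_mono mult_pos_pos zero_less_power) auto
    also have "\<dots> = 1 / emeasure lebesgue (qcube c' \<rho>')"
      using \<rho>' by (simp add: emeasure_qcube divide_ennreal ennreal_1[symmetric] del: ennreal_1)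
    also have "?I * \<dots> \<le> (\<integral>\<^sup>+x\<in>qcube c' \<rho>'. F x \<partial>lebesgue) * (1 / emeasure lebesgue (qcube c' \<rho>'))"
      using c'(2) by (intro mult_right_mono nn_integral_mono) (auto simp: indicator_def)
    also have "\<dots> \<le> maxop \<D> lebesgue F x"
      using average_le_maxop[OF c'(1), of x lebesgue F] c'(2) x by (auto simp: ennreal_times_divide)
    finally show ?thesis by (simp add: mult_left_mono)
  qed
  have "(\<lambda>n. 1 / real (Suc n)) \<longlonglongrightarrow> 0" by (rule LIMSEQ_Suc[OF lim_1_over_n])
  then have "e \<longlonglongrightarrow> (\<rho> / (\<rho> + 0)) ^ ?d"
    unfolding e_def s_def using \<rho> by (intro tendsto_intros) auto
  then have "(\<lambda>n. mean ?Q F * ennreal (e n)) \<longlonglongrightarrow> mean ?Q F * ennreal 1"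
    using \<rho> by (intro tendsto_mult_ennreal tendsto_ennrealI tendsto_const) auto
  then show ?thesis
    using bound by (intro LIMSEQ_le_const2[of _ "mean ?Q F"]) auto
qed

lemma maximal_eq_maxop:
  fixes \<D> :: "('a::euclidean_space \<times> real) set"
  assumes dense: "\<And>c \<rho> \<epsilon>. 0 < \<rho> \<Longrightarrow> 0 < \<epsilon> \<Longrightarrow>
      \<exists>c' \<rho>'. (c', \<rho>') \<in> \<D> \<and> qcube c \<rho> \<subseteq> qcube c' \<rho>' \<and> \<rho>' \<le> \<rho> + \<epsilon>"
    and pos: "\<And>c \<rho>. (c, \<rho>) \<in> \<D> \<Longrightarrow> 0 < \<rho>"
    and r: "0 < r"
  shows "maximal r f x = ennpowr (maxop \<D> lebesgue (\<lambda>x. ennreal (norm (f x) powr r)) x) (1 / r)"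
proof (rule antisym)
  let ?F = "\<lambda>x. ennreal (norm (f x) powr r)"
  show "maximal r f x \<le> ennpowr (maxop \<D> lebesgue ?F x) (1 / r)"
    unfolding maximal_def
  proof (rule SUP_least)
    fix Q :: "'a set" assume "Q \<in> cubes"
    then obtain c \<rho> where Q: "Q = qcube c \<rho>" "0 < \<rho>" by (auto simp: cubes_eq_qcube)
    show "p_mean r Q f * indicator Q x \<le> ennpowr (maxop \<D> lebesgue ?F x) (1 / r)"
    proof (cases "x \<in> Q")
      case True
      have "mean Q ?F \<le> maxop \<D> lebesgue ?F x"
        unfolding Q(1) by (rule mean_le_maxop; fact dense pos Q(2) True[unfolded Q(1)])
      then show ?thesis
        using r True by (simp add: p_mean_def ennpowr_mono)
    qed simp
  qed
  have "maxop \<D> lebesgue ?F x \<le> ennpowr (maximal r f x) r"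
    unfolding maxop_def
  proof (rule SUP_least, clarify)
    fix c \<rho> assume c: "(c, \<rho>) \<in> \<D>"
    let ?Q = "qcube c \<rho>"
    show "(\<integral>\<^sup>+x\<in>?Q. ?F x \<partial>lebesgue) / emeasure lebesgue ?Q * indicator ?Q x \<le> ennpowr (maximal r f x) r"
    proof (cases "x \<in> ?Q")
      case True
      have "p_mean r ?Q f * indicator ?Q x \<le> maximal r f x"
        unfolding maximal_def by (intro SUP_upper qcube_in_cubes pos[OF c])
      then have "ennpowr (p_mean r ?Q f) r \<le> ennpowr (maximal r f x) r"
        using True r by (intro ennpowr_mono) auto
      then show ?thesis
        using True r by (simp add: p_mean_def ennpowr_ennpowr mean_def)
    qed simp
  qed
  then have "ennpowr (maxop \<D> lebesgue ?F x) (1 / r) \<le> ennpowr (ennpowr (maximal r f x) r) (1 / r)"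
    using r by (intro ennpowr_mono) auto
  then show "ennpowr (maxop \<D> lebesgue ?F x) (1 / r) \<le> maximal r f x"
    using r by (simp add: ennpowr_ennpowr)
qed

lemma measurable_maximal [measurable]:
  assumes "0 < r"
  shows "maximal r f \<in> borel_measurable lebesgue"
proof -
  obtain \<D> :: "('a \<times> real) set" where \<D>: "countable \<D>"
    "\<And>c \<rho>. (c, \<rho>) \<in> \<D> \<Longrightarrow> 0 < \<rho>"
    "\<And>c \<rho> \<epsilon>. 0 < \<rho> \<Longrightarrow> 0 < \<epsilon> \<Longrightarrow>
      \<exists>c' \<rho>'. (c', \<rho>') \<in> \<D> \<and> qcube c \<rho> \<subseteq> qcube c' \<rho>' \<and> \<rho>' \<le> \<rho> + \<epsilon>"
    by (rule countable_qcube_family) blast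
  have [measurable]: "maxop \<D> lebesgue F \<in> borel_measurable lebesgue" for F
    using measurable_maxop[OF \<D>(1)] by simp
  have "maximal r f = (\<lambda>x. ennpowr (maxop \<D> lebesgue (\<lambda>x. ennreal (norm (f x) powr r)) x) (1 / r))"
    by (rule ext, rule maximal_eq_maxop; fact \<D> assms)
  then show ?thesis by simp
qed

lemma ennreal_norm_le_suminf:
  fixes z :: "'b::real_normed_vector"
  assumes "a sums z"
  shows "ennreal (norm z) \<le> (\<Sum>n. ennreal (norm (a n)))"
proof -
  have lim: "(\<lambda>n. ennreal (norm (\<Sum>i<n. a i))) \<longlonglongrightarrow> ennreal (norm z)"
    using assms unfolding sums_def by (intro tendsto_ennrealI tendsto_norm)
  have "ennreal (norm (\<Sum>i<n. a i)) \<le> (\<Sum>n. ennreal (norm (a n)))" for n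
  proof -
    have "ennreal (norm (\<Sum>i<n. a i)) \<le> ennreal (\<Sum>i<n. norm (a i))"
      by (intro ennreal_leI norm_sum)
    also have "\<dots> = (\<Sum>i<n. ennreal (norm (a i)))" by simp
    also have "\<dots> \<le> (\<Sum>n. ennreal (norm (a n)))" by (intro sum_le_suminf) auto
    finally show ?thesis .
  qed
  then show ?thesis by (intro LIMSEQ_le_const2[OF lim]) blast
qed

text \<open>Minkowski's inequality on each cube separately, before the supremum is taken.\<close>

lemma maximal_suminf_le:
  assumes r: "1 \<le> r" and a [measurable]: "\<And>n. a n \<in> borel_measurable lebesgue"
    and f: "AE x in lebesgue. (\<lambda>n. c n * a n x) sums f x"
  shows "maximal r f x \<le> (\<Sum>n. ennreal (norm (c n)) * maximal r (a n) x)"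
  unfolding maximal_def[of r f]
proof (rule SUP_least)
  fix Q :: "'a set" assume Qc: "Q \<in> cubes"
  then obtain y \<rho> where Q: "Q = qcube y \<rho>" "0 < \<rho>" by (auto simp: cubes_eq_qcube)
  have [measurable]: "Q \<in> sets lebesgue" by (simp add: Q)
  let ?g = "\<lambda>n x. ennreal (norm (c n * a n x)) * indicator Q x"
  have m: "ennpowr (emeasure lebesgue Q) (1 / r) \<noteq> 0" "ennpowr (emeasure lebesgue Q) (1 / r) \<noteq> top"
    using Q by (simp_all add: emeasure_qcube ennreal_eq_0_iff not_le)
  have int_a: "(\<integral>\<^sup>+x. ennpowr (?g n x) r \<partial>lebesgue)
      = ennreal (norm (c n) powr r) * (\<integral>\<^sup>+x\<in>Q. ennreal (norm (a n x) powr r) \<partial>lebesgue)" for n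
    by (subst nn_integral_cmult[symmetric])
      (auto simp: ennpowr_mult ennpowr_ennreal norm_mult powr_mult ennreal_mult mult.assoc indicator_def
        intro!: nn_integral_cong)
  have "AE x in lebesgue. ennreal (norm (f x) powr r) * indicator Q x \<le> ennpowr (\<Sum>n. ?g n x) r"
    using f
  proof eventually_elim
    case (elim x)
    show ?case
    proof (cases "x \<in> Q")
      case True
      have "ennpowr (ennreal (norm (f x))) r \<le> ennpowr (\<Sum>n. ennreal (norm (c n * a n x))) r"
        using r by (intro ennpowr_mono ennreal_norm_le_suminf elim) auto
      then show ?thesis using True by (simp add: ennpowr_ennreal)
    qed simp
  qed
  then have "(\<integral>\<^sup>+x\<in>Q. ennreal (norm (f x) powr r) \<partial>lebesgue) \<le> (\<integral>\<^sup>+x. ennpowr (\<Sum>n. ?g n x) r \<partial>lebesgue)"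
    by (rule nn_integral_mono_AE)
  then have "ennpowr (\<integral>\<^sup>+x\<in>Q. ennreal (norm (f x) powr r) \<partial>lebesgue) (1 / r)
      \<le> ennpowr (\<integral>\<^sup>+x. ennpowr (\<Sum>n. ?g n x) r \<partial>lebesgue) (1 / r)"
    using r by (intro ennpowr_mono) auto
  also have "\<dots> \<le> (\<Sum>n. ennpowr (\<integral>\<^sup>+x. ennpowr (?g n x) r \<partial>lebesgue) (1 / r))"
    by (intro nn_integral_Minkowski_suminf r) auto
  also have "\<dots> = (\<Sum>n. ennreal (norm (c n)) * ennpowr (\<integral>\<^sup>+x\<in>Q. ennreal (norm (a n x) powr r) \<partial>lebesgue) (1 / r))"
    unfolding int_a using r by (simp add: ennpowr_mult ennpowr_ennreal powr_powr)
  finally have "p_mean r Q f \<le> (\<Sum>n. ennreal (norm (c n))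
      * ennpowr (\<integral>\<^sup>+x\<in>Q. ennreal (norm (a n x) powr r) \<partial>lebesgue) (1 / r)) / ennpowr (emeasure lebesgue Q) (1 / r)"
    using m by (simp add: p_mean_def mean_def ennpowr_divide divide_right_mono_ennreal)
  also have "\<dots> = (\<Sum>n. ennreal (norm (c n)) * p_mean r Q (a n))"
    using m by (simp add: p_mean_def mean_def ennpowr_divide ennreal_times_divide
        flip: ennreal_suminf_divide)
  finally have "p_mean r Q f * indicator Q x \<le> (\<Sum>n. ennreal (norm (c n)) * (p_mean r Q (a n) * indicator Q x))"
    by (auto simp: indicator_def)
  also have "\<dots> \<le> (\<Sum>n. ennreal (norm (c n)) * maximal r (a n) x)"
    unfolding maximal_def using Qc by (intro suminf_le mult_left_mono SUP_upper) auto
  finally show "p_mean r Q f * indicator Q x \<le> (\<Sum>n. ennreal (norm (c n)) * maximal r (a n) x)" .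
qed

text \<open>A cube that contains \<open>x\<close> and meets \<open>qcube c \<rho>\<close> has half side length at least \<open>(R - \<rho>) / 2\<close>, hence at
  least \<open>R / 3\<close>. Its volume is therefore at least the fraction \<open>9\<^sup>-\<^sup>d\<close> of that of \<open>qcube c (3 * R)\<close>.\<close>

lemma maxop_far_le:
  fixes c :: "'a::euclidean_space"
  assumes pos: "\<And>c \<rho>. (c, \<rho>) \<in> \<D> \<Longrightarrow> 0 < \<rho>"
    and \<rho>: "0 < \<rho>" "3 * \<rho> \<le> R" and x: "x \<notin> qcube c R"
    and supp: "AE y in lebesgue. y \<notin> qcube c \<rho> \<longrightarrow> F y = 0"
  shows "maxop \<D> lebesgue F x
    \<le> ennreal (9 ^ DIM('a) / (2 * (3 * R)) ^ DIM('a)) * (\<integral>\<^sup>+y\<in>qcube c \<rho>. F y \<partial>lebesgue)"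
  unfolding maxop_def
proof (rule SUP_least, clarify)
  fix c' \<rho>' assume c': "(c', \<rho>') \<in> \<D>"
  have \<rho>': "0 < \<rho>'" by (rule pos[OF c'])
  let ?Q = "qcube c \<rho>" and ?Q' = "qcube c' \<rho>'" and ?d = "DIM('a)"
  let ?K = "ennreal (9 ^ ?d / (2 * (3 * R)) ^ ?d)"
  show "(\<integral>\<^sup>+y\<in>?Q'. F y \<partial>lebesgue) / emeasure lebesgue ?Q' * indicator ?Q' x
      \<le> ?K * (\<integral>\<^sup>+y\<in>?Q. F y \<partial>lebesgue)"
  proof (cases "x \<in> ?Q'")
    case True
    show ?thesis
    proof (cases "?Q \<inter> ?Q' = {}")
      case True
      have "(\<integral>\<^sup>+y\<in>?Q'. F y \<partial>lebesgue) = (\<integral>\<^sup>+y. 0 \<partial>(lebesgue::'a measure))"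
      proof (rule nn_integral_cong_AE)
        show "AE y in lebesgue. F y * indicator ?Q' y = 0"
          using supp
        proof eventually_elim
          case (elim y)
          then show ?case using True by (auto simp: indicator_def)
        qed
      qed
      then show ?thesis by simp
    next
      case False
      then obtain y where y: "y \<in> ?Q" "y \<in> ?Q'" by auto
      obtain i :: 'a where i: "i \<in> Basis" "R < \<bar>x \<bullet> i - c \<bullet> i\<bar>"
        using x by (auto simp: mem_qcube not_le)
      have "\<bar>y \<bullet> i - c \<bullet> i\<bar> \<le> \<rho>" "\<bar>y \<bullet> i - c' \<bullet> i\<bar> \<le> \<rho>'" "\<bar>x \<bullet> i - c' \<bullet> i\<bar> \<le> \<rho>'"
        using y True i by (auto simp: mem_qcube)
      then have big: "R / 3 \<le> \<rho>'" using i \<rho> by linarith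
      have "(\<integral>\<^sup>+y\<in>?Q'. F y \<partial>lebesgue) \<le> (\<integral>\<^sup>+y\<in>?Q. F y \<partial>lebesgue)"
      proof (rule nn_integral_mono_AE)
        show "AE y in lebesgue. F y * indicator ?Q' y \<le> F y * indicator ?Q y"
          using supp
        proof eventually_elim
          case (elim y)
          then show ?case by (cases "y \<in> ?Q") (auto simp: indicator_def)
        qed
      qed
      then have "(\<integral>\<^sup>+y\<in>?Q'. F y \<partial>lebesgue) / emeasure lebesgue ?Q'
          \<le> (\<integral>\<^sup>+y\<in>?Q. F y \<partial>lebesgue) / emeasure lebesgue ?Q'"
        by (rule divide_right_mono_ennreal)
      also have "\<dots> = (1 / emeasure lebesgue ?Q') * (\<integral>\<^sup>+y\<in>?Q. F y \<partial>lebesgue)"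
        by (simp only: mult.commute[of "1 / emeasure lebesgue ?Q'"] ennreal_times_divide mult_1_right)
      also have "\<dots> \<le> ?K * (\<integral>\<^sup>+y\<in>?Q. F y \<partial>lebesgue)"
      proof (intro mult_right_mono)
        have "1 / emeasure lebesgue ?Q' = ennreal (1 / (2 * \<rho>') ^ ?d)"
          using \<rho>' by (simp add: emeasure_qcube divide_ennreal ennreal_1[symmetric] del: ennreal_1)
        also have "1 / (2 * \<rho>') ^ ?d \<le> 1 / (2 * (R / 3)) ^ ?d"
          using big \<rho> \<rho>' by (intro divide_left_mono power_mono mult_pos_pos zero_less_power) auto
        also have "1 / (2 * (R / 3)) ^ ?d = 9 ^ ?d / (2 * (3 * R)) ^ ?d"
        proof -
          have "(9 * (2 * (R / 3))) ^ ?d = 9 ^ ?d * (2 * (R / 3)) ^ ?d" by (rule power_mult_distrib)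
          moreover have "9 * (2 * (R / 3)) = 2 * (3 * R)" by simp
          moreover have "(2 * (R / 3)) ^ ?d \<noteq> 0" using \<rho> by simp
          ultimately show ?thesis by (simp only: nonzero_mult_divide_mult_cancel_left) (simp add: field_simps)
        qed
        finally show "1 / emeasure lebesgue ?Q' \<le> ?K" by (simp add: ennreal_leI)
      qed auto
      finally show ?thesis using \<open>x \<in> ?Q'\<close> by simp
    qed
  qed auto
qed

section \<open>Blocks\<close>

text \<open>The normalization of a block says that the integral of \<open>\<bar>b\<bar>\<^sup>p\<close> is at most \<open>\<bar>Q\<bar>\<^sup>1\<^sup>-\<^sup>p\<^sup>/\<^sup>q\<close>, which is the form in
  which it is used and verified.\<close>

lemma block_norm_iff:
  fixes b :: "'a::euclidean_space \<Rightarrow> complex"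
  assumes \<rho>: "0 < \<rho>" and supp: "AE x in lebesgue. x \<notin> qcube c \<rho> \<longrightarrow> b x = 0" and p: "0 < p"
  shows "ennpowr (emeasure lebesgue (qcube c \<rho>)) (1 / q) * p_mean p (qcube c \<rho>) b \<le> 1
    \<longleftrightarrow> (\<integral>\<^sup>+x. ennreal (norm (b x) powr p) \<partial>lebesgue) \<le> ennreal (((2 * \<rho>) ^ DIM('a)) powr (1 - p / q))"
proof -
  define V where "V = (2 * \<rho>) ^ DIM('a)"
  have V: "0 < V" using \<rho> by (simp add: V_def)
  define I where "I = (\<integral>\<^sup>+x. ennreal (norm (b x) powr p) \<partial>lebesgue)"
  have vol: "emeasure lebesgue (qcube c \<rho>) = ennreal V"
    unfolding V_def using \<rho> by (intro emeasure_qcube) auto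
  have "(\<integral>\<^sup>+x\<in>qcube c \<rho>. ennreal (norm (b x) powr p) \<partial>lebesgue) = I"
    unfolding I_def using supp by (intro nn_integral_cong_AE) (auto elim!: eventually_mono simp: indicator_def)
  then have "ennpowr (emeasure lebesgue (qcube c \<rho>)) (1 / q) * p_mean p (qcube c \<rho>) b
      = ennreal (V powr (1 / q)) * ennpowr (I / ennreal V) (1 / p)"
    using V by (simp add: p_mean_def mean_def vol ennpowr_ennreal)
  moreover have "ennreal (V powr (1 / q)) * ennpowr (I / ennreal V) (1 / p) \<le> 1
      \<longleftrightarrow> I \<le> ennreal (V powr (1 - p / q))"
  proof (cases I)
    case (real i)
    have "ennreal (V powr (1 / q)) * ennpowr (I / ennreal V) (1 / p) \<le> 1
        \<longleftrightarrow> V powr (1 / q) * (i / V) powr (1 / p) \<le> 1"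
      using real V by (simp add: divide_ennreal ennpowr_ennreal ennreal_mult[symmetric])
    also have "\<dots> \<longleftrightarrow> (V powr (1 / q) * (i / V) powr (1 / p)) powr p \<le> 1 powr p"
    proof -
      have "y \<le> 1 \<longleftrightarrow> y powr p \<le> 1 powr p" if "0 \<le> y" for y :: real
      proof (cases "y \<le> 1")
        case True
        then show ?thesis using powr_mono2[of p y 1] p that by simp
      next
        case False
        then have "1 powr p < y powr p" using p by (intro powr_less_mono2) auto
        then show ?thesis using False by simp
      qed
      then show ?thesis by this simp
    qed
    also have "(V powr (1 / q) * (i / V) powr (1 / p)) powr p = V powr (p / q) * (i / V)"
      using p V real by (simp add: powr_mult powr_powr)
    also have "V powr (p / q) * (i / V) \<le> 1 powr p \<longleftrightarrow> i \<le> V powr (1 - p / q)"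
      using V by (simp add: powr_diff field_simps)
    finally show ?thesis using real by simp
  next
    case top
    then show ?thesis using V by (simp add: ennreal_top_divide ennreal_mult_top top_unique)
  qed
  ultimately show ?thesis by (simp add: V_def I_def)
qed

lemma is_blockE:
  fixes b :: "'a::euclidean_space \<Rightarrow> complex"
  assumes "is_block p q b" "0 < p"
  obtains c \<rho> where "0 < \<rho>" "AE x in lebesgue. x \<notin> qcube c \<rho> \<longrightarrow> b x = 0"
    "(\<integral>\<^sup>+x. ennreal (norm (b x) powr p) \<partial>lebesgue) \<le> ennreal (((2 * \<rho>) ^ DIM('a)) powr (1 - p / q))"
proof -
  obtain Q where Q: "Q \<in> cubes" "AE x in lebesgue. x \<notin> Q \<longrightarrow> b x = 0"
    "ennpowr (emeasure lebesgue Q) (1 / q) * p_mean p Q b \<le> 1"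
    using assms by (auto simp: is_block_def)
  then obtain c \<rho> where c: "Q = qcube c \<rho>" "0 < \<rho>" by (auto simp: cubes_eq_qcube)
  show ?thesis
    using Q(2,3) block_norm_iff[OF c(2) _ assms(2), of c b q] unfolding c(1)
    by (intro that[OF c(2)]) auto
qed

lemma is_blockI:
  fixes b :: "'a::euclidean_space \<Rightarrow> complex"
  assumes "b \<in> borel_measurable lebesgue" "0 < p" "0 < \<rho>"
    and "AE x in lebesgue. x \<notin> qcube c \<rho> \<longrightarrow> b x = 0"
    and "(\<integral>\<^sup>+x. ennreal (norm (b x) powr p) \<partial>lebesgue) \<le> ennreal (((2 * \<rho>) ^ DIM('a)) powr (1 - p / q))"
  shows "is_block p q b"
  unfolding is_block_def
  using assms block_norm_iff[OF assms(3,4,2), of q] by (auto intro!: bexI[OF _ qcube_in_cubes[OF assms(3)]])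

lemma is_block_dominated:
  assumes "is_block p q b" "0 < p" "b' \<in> borel_measurable lebesgue" "\<And>x. norm (b' x) \<le> norm (b x)"
  shows "is_block p q b'"
proof -
  obtain c \<rho> where c: "0 < \<rho>" "AE x in lebesgue. x \<notin> qcube c \<rho> \<longrightarrow> b x = 0"
    "(\<integral>\<^sup>+x. ennreal (norm (b x) powr p) \<partial>lebesgue) \<le> ennreal (((2 * \<rho>) ^ DIM('a)) powr (1 - p / q))"
    by (rule is_blockE[OF assms(1,2)])
  show ?thesis
  proof (rule is_blockI[OF assms(3,2) c(1)])
    show "AE x in lebesgue. x \<notin> qcube c \<rho> \<longrightarrow> b' x = 0"
      using c(2)
    proof eventually_elim
      case (elim x)
      then show ?case using assms(4)[of x] by auto
    qed
    have "(\<integral>\<^sup>+x. ennreal (norm (b' x) powr p) \<partial>lebesgue) \<le> (\<integral>\<^sup>+x. ennreal (norm (b x) powr p) \<partial>lebesgue)"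
      using assms by (intro nn_integral_mono ennreal_leI powr_mono2) auto
    with c(3) show "(\<integral>\<^sup>+x. ennreal (norm (b' x) powr p) \<partial>lebesgue) \<le> ennreal (((2 * \<rho>) ^ DIM('a)) powr (1 - p / q))"
      by (rule order_trans[rotated])
  qed
qed

text \<open>Holder's inequality on the set \<open>E\<close> where the cube meets the support of the block gives the
  bound \<open>\<bar>Q\<bar>\<^sup>1\<^sup>/\<^sup>p\<^sup>-\<^sup>1\<^sup>/\<^sup>q \<bar>E\<bar>\<^sup>1\<^sup>-\<^sup>1\<^sup>/\<^sup>p\<close>. The first exponent is not positive because \<open>q \<le> p\<close>, so \<open>Q\<close> may be replaced
  by its subset \<open>E\<close>; the resulting bound does not depend on the block.\<close>

lemma block_nn_integral_qcube_le:
  fixes b :: "'a::euclidean_space \<Rightarrow> complex"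
  assumes b: "is_block p q b" and pq: "1 < q" "q \<le> p" and N: "0 < N"
  shows "(\<integral>\<^sup>+x\<in>qcube z N. ennreal (norm (b x)) \<partial>lebesgue)
    \<le> ennreal (((2 * N) ^ DIM('a)) powr (1 - 1 / q))"
proof -
  have p: "1 < p" using pq by simp
  have [measurable]: "b \<in> borel_measurable lebesgue" using b by (simp add: is_block_def)
  have "0 < p" using p by simp
  from is_blockE[OF b this] obtain c \<rho> where c: "0 < \<rho>"
    and supp: "AE x in lebesgue. x \<notin> qcube c \<rho> \<longrightarrow> b x = 0"
    and int: "(\<integral>\<^sup>+x. ennreal (norm (b x) powr p) \<partial>lebesgue) \<le> ennreal (((2 * \<rho>) ^ DIM('a)) powr (1 - p / q))"
    by blast
  define V where "V = (2 * \<rho>) ^ DIM('a)"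
  define W where "W = (2 * N) ^ DIM('a)"
  have VW: "0 < V" "0 < W" using c N by (auto simp: V_def W_def)
  define E where "E = qcube z N \<inter> qcube c \<rho>"
  have [measurable]: "E \<in> sets lebesgue" by (simp add: E_def sets.Int)
  have E: "emeasure lebesgue E \<le> ennreal V" "emeasure lebesgue E \<le> ennreal W"
    using emeasure_mono[of E "qcube c \<rho>" lebesgue] emeasure_mono[of E "qcube z N" lebesgue] c N
    by (auto simp: E_def emeasure_qcube V_def W_def)
  then obtain e where e: "emeasure lebesgue E = ennreal e" "0 \<le> e"
    by (cases "emeasure lebesgue E") (auto simp: top_unique)
  then have eVW: "e \<le> V" "e \<le> W" using E VW by (auto simp: ennreal_le_iff)
  have "(\<integral>\<^sup>+x\<in>qcube z N. ennreal (norm (b x)) \<partial>lebesgue)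
      = (\<integral>\<^sup>+x. ennpowr (ennreal (norm (b x) powr p)) (1 / p) * ennpowr (indicator E x) (1 - 1 / p) \<partial>lebesgue)"
  proof (rule nn_integral_cong_AE)
    show "AE x in lebesgue. ennreal (norm (b x)) * indicator (qcube z N) x
      = ennpowr (ennreal (norm (b x) powr p)) (1 / p) * ennpowr (indicator E x) (1 - 1 / p)"
      using supp
    proof eventually_elim
      case (elim x)
      then show ?case
        using p by (auto simp: ennpowr_ennreal powr_powr E_def indicator_def)
    qed
  qed
  also have "\<dots> \<le> ennpowr (\<integral>\<^sup>+x. ennreal (norm (b x) powr p) \<partial>lebesgue) (1 / p)
      * ennpowr (\<integral>\<^sup>+x. indicator E x \<partial>lebesgue) (1 - 1 / p)"
    using p by (intro nn_integral_Holder) auto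
  also have "\<dots> \<le> ennpowr (ennreal (V powr (1 - p / q))) (1 / p) * ennpowr (ennreal e) (1 - 1 / p)"
    using p int by (intro mult_mono ennpowr_mono) (auto simp: V_def e)
  also have "\<dots> = ennreal (V powr (1 / p - 1 / q) * e powr (1 - 1 / p))"
  proof -
    have "(1 - p / q) * (1 / p) = 1 / p - 1 / q" using p by (simp add: field_simps)
    then show ?thesis using e by (simp add: ennpowr_ennreal powr_powr ennreal_mult del: times_divide_eq_right)
  qed
  also have "V powr (1 / p - 1 / q) * e powr (1 - 1 / p) \<le> W powr (1 - 1 / q)"
  proof (cases "e = 0")
    case False
    have "1 / p - 1 / q \<le> 0" using pq by (simp add: frac_le)
    then have "V powr (1 / p - 1 / q) \<le> e powr (1 / p - 1 / q)"
      using False e eVW by (intro powr_mono2') auto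
    then have "V powr (1 / p - 1 / q) * e powr (1 - 1 / p) \<le> e powr (1 / p - 1 / q) * e powr (1 - 1 / p)"
      by (intro mult_right_mono) auto
    also have "\<dots> = e powr (1 - 1 / q)" by (simp add: powr_add[symmetric])
    also have "\<dots> \<le> W powr (1 - 1 / q)" using e eVW pq by (intro powr_mono2) auto
    finally show ?thesis .
  qed simp
  finally show ?thesis by (simp add: W_def ennreal_leI)
qed

lemma AE_in_qcubes:
  assumes "\<And>N::nat. AE x in lebesgue. x \<in> qcube (0::'a::euclidean_space) (real (Suc N)) \<longrightarrow> P x"
  shows "AE x in lebesgue. P x"
proof -
  have "AE x in lebesgue. \<forall>N::nat. x \<in> qcube (0::'a) (real (Suc N)) \<longrightarrow> P x"
    unfolding AE_all_countable by (intro allI assms)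
  then show ?thesis
  proof eventually_elim
    case (elim x)
    obtain n where "x \<in> qcube 0 (real (Suc n))" using qcube_exhaust by blast
    then show ?case using elim by blast
  qed
qed

text \<open>The blocks are uniformly bounded in \<open>L\<^sup>1\<close> of every cube, so the series has a finite integral over
  every cube.\<close>

lemma AE_block_series_finite:
  fixes b :: "nat \<Rightarrow> 'a::euclidean_space \<Rightarrow> complex"
  assumes b: "\<And>n. is_block p q (b n)" and pq: "1 < q" "q \<le> p"
    and \<mu>: "(\<Sum>n. \<mu> n) \<noteq> (top::ennreal)"
  shows "AE x in lebesgue. (\<Sum>n. \<mu> n * ennreal (norm (b n x))) < top"
proof (rule AE_in_qcubes)
  fix N :: nat
  have [measurable]: "b n \<in> borel_measurable lebesgue" for n using b by (simp add: is_block_def)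
  let ?R = "qcube (0::'a) (real (Suc N))"
  let ?W = "((2 * real (Suc N)) ^ DIM('a)) powr (1 - 1 / q)"
  have "(\<integral>\<^sup>+x\<in>?R. (\<Sum>n. \<mu> n * ennreal (norm (b n x))) \<partial>lebesgue)
      = (\<Sum>n. \<mu> n * (\<integral>\<^sup>+x\<in>?R. ennreal (norm (b n x)) \<partial>lebesgue))"
    by (simp add: nn_integral_suminf nn_integral_cmult mult.assoc flip: ennreal_suminf_multc)
  also have "\<dots> \<le> (\<Sum>n. \<mu> n * ennreal ?W)"
    by (intro suminf_le mult_left_mono block_nn_integral_qcube_le[OF b pq]) auto
  also have "\<dots> < top" using \<mu> by (simp add: ennreal_mult_less_top less_top)
  finally have "AE x in lebesgue. (\<Sum>n. \<mu> n * ennreal (norm (b n x))) * indicator ?R x \<noteq> top"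
    by (intro nn_integral_PInf_AE[unfolded infinity_ennreal_def]) (auto simp: less_top)
  then show "AE x in lebesgue. x \<in> ?R \<longrightarrow> (\<Sum>n. \<mu> n * ennreal (norm (b n x))) < top"
    by eventually_elim (auto simp: less_top)
qed

text \<open>The block space is an ideal: if \<open>h\<close> is the sum of the majorizing series, then multiplication of
  every block by the quotient \<open>g / h\<close>, which is at most 1, turns a representation of \<open>h\<close> into one of \<open>g\<close>
  with the same coefficients.\<close>

lemma block_representation_of_majorant:
  fixes g :: "'a::euclidean_space \<Rightarrow> ennreal" and \<beta> :: "nat \<Rightarrow> 'a \<Rightarrow> real"
  assumes pq: "1 < q" "q \<le> p" and g [measurable]: "g \<in> borel_measurable lebesgue"
    and \<mu>: "\<And>n. 0 \<le> \<mu> n" "summable \<mu>"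
    and \<beta>: "\<And>n x. 0 \<le> \<beta> n x" "\<And>n. is_block p q (\<lambda>x. complex_of_real (\<beta> n x))"
    and le: "AE x in lebesgue. g x \<le> (\<Sum>n. ennreal (\<mu> n) * ennreal (\<beta> n x))"
  shows "AE x in lebesgue. g x < top"
    and "\<exists>b. block_representation p q (\<lambda>x. complex_of_real (enn2real (g x))) (\<lambda>n. complex_of_real (\<mu> n)) b"
proof -
  have m\<beta>: "(\<lambda>x. complex_of_real (\<beta> n x)) \<in> borel_measurable lebesgue" for n
    using \<beta>(2) by (simp add: is_block_def)
  have "(\<lambda>x. Re (complex_of_real (\<beta> n x))) \<in> borel_measurable lebesgue" for n
    by (rule measurable_compose[OF m\<beta>]) measurable
  then have [measurable]: "\<beta> n \<in> borel_measurable lebesgue" for n by simp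
  define h where "h x = (\<Sum>n. ennreal (\<mu> n) * ennreal (\<beta> n x))" for x
  have [measurable]: "h \<in> borel_measurable lebesgue" unfolding h_def by measurable
  have "(\<Sum>n. ennreal (\<mu> n)) \<noteq> top"
    using \<mu> by (simp add: suminf_ennreal2)
  then have "AE x in lebesgue. (\<Sum>n. ennreal (\<mu> n) * ennreal (norm (complex_of_real (\<beta> n x)))) < top"
    by (intro AE_block_series_finite[OF \<beta>(2) pq])
  then have fin: "AE x in lebesgue. h x < top" using \<beta>(1) by (simp add: h_def)
  show "AE x in lebesgue. g x < top"
    using le fin by eventually_elim (simp add: h_def)
  \<comment> \<open>The minimum keeps the multiplier at most 1 on the null set where \<open>g \<le> h\<close> fails as well.\<close>
  define \<phi> where "\<phi> x = min 1 (enn2real (g x / h x))" for x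
  have [measurable]: "\<phi> \<in> borel_measurable lebesgue" unfolding \<phi>_def by measurable
  have \<phi>: "0 \<le> \<phi> x" "\<phi> x \<le> 1" for x by (auto simp: \<phi>_def)
  have "block_representation p q (\<lambda>x. complex_of_real (enn2real (g x))) (\<lambda>n. complex_of_real (\<mu> n))
      (\<lambda>n x. complex_of_real (\<phi> x * \<beta> n x))"
    unfolding block_representation_def
  proof (intro conjI allI)
    show "summable (\<lambda>n. norm (complex_of_real (\<mu> n)))" using \<mu> by simp
    show "is_block p q (\<lambda>x. complex_of_real (\<phi> x * \<beta> n x))" for n
    proof (rule is_block_dominated[OF \<beta>(2)])
      show "norm (complex_of_real (\<phi> x * \<beta> n x)) \<le> norm (complex_of_real (\<beta> n x))" for x
        using \<phi>[of x] \<beta>(1)[of n x] by (simp add: norm_mult mult_left_le_one_le)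
    qed (use pq in auto)
    show "AE x in lebesgue. (\<lambda>n. complex_of_real (\<mu> n) * complex_of_real (\<phi> x * \<beta> n x))
        sums complex_of_real (enn2real (g x))"
      using le fin
    proof eventually_elim
      case (elim x)
      have nn: "0 \<le> \<mu> n * \<beta> n x" for n using \<mu> \<beta> by simp
      have h: "h x = (\<Sum>n. ennreal (\<mu> n * \<beta> n x))" using \<mu> \<beta> by (simp add: h_def ennreal_mult)
      then have sm: "summable (\<lambda>n. \<mu> n * \<beta> n x)"
        using elim(2) nn by (intro summable_suminf_not_top) auto
      define H where "H = (\<Sum>n. \<mu> n * \<beta> n x)"
      have H: "h x = ennreal H" "0 \<le> H"
        unfolding h H_def using sm nn by (auto simp: suminf_ennreal2 suminf_nonneg)
      have "g x \<le> ennreal H" using elim(1) H by (simp add: h_def)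
      then obtain y where y: "g x = ennreal y" "0 \<le> y" "y \<le> H"
        using H by (cases "g x") (auto simp: top_unique ennreal_le_iff)
      have "\<phi> x * H = y"
      proof (cases "H = 0")
        case False
        then show ?thesis using y H by (auto simp: \<phi>_def divide_ennreal field_simps)
      qed (use y in auto)
      moreover have "(\<lambda>n. \<phi> x * (\<mu> n * \<beta> n x)) sums (\<phi> x * H)"
        unfolding H_def by (intro sums_mult summable_sums sm)
      ultimately have "(\<lambda>n. \<mu> n * (\<phi> x * \<beta> n x)) sums y"
        by (simp add: mult.left_commute)
      then show ?case
        using y by (simp add: sums_of_real_iff flip: of_real_mult)
    qed
  qed
  then show "\<exists>b. block_representation p q (\<lambda>x. complex_of_real (enn2real (g x))) (\<lambda>n. complex_of_real (\<mu> n)) b"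
    by blast
qed

section \<open>Boundedness on the weighted block space\<close>

locale block_weight =
  fixes p q r :: real and v :: "'a::euclidean_space \<Rightarrow> real"
  assumes p: "1 < p" and q: "1 < q" "q \<le> p" and r: "1 \<le> r" "r < q"
    and v: "weight v"
    and muckenhoupt: "(\<lambda>x. v x powr p) \<in> muckenhoupt (p * (1 / r - 1 / q) + 1)"
begin

definition "\<tau> = p * (1 / r - 1 / q)"

definition "w x = ennreal (v x powr p)"

definition "\<sigma> x = ennreal (v x powr (- (p / \<tau>)))"

lemma \<tau>_pos: "0 < \<tau>"
  using p q r by (simp add: \<tau>_def field_simps)

text \<open>This is where \<open>q \<le> p\<close> matters for the weight: the hypothesis \<open>v\<^sup>p \<in> A\<^sub>1\<^sub>+\<^sub>\<tau>\<close> contains the condition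
  \<open>v\<^sup>p \<in> A\<^sub>p\<^sub>/\<^sub>r\<close> under which \<open>M\<^sub>r\<close> is bounded on \<open>L\<^sup>p(v\<^sup>p)\<close>.\<close>

lemma \<tau>_le: "1 + \<tau> \<le> p / r"
proof -
  have "1 \<le> p / q" using q by simp
  then show ?thesis by (simp add: \<tau>_def right_diff_distrib)
qed

lemma v_measurable [measurable]: "v \<in> borel_measurable lebesgue"
  and v_pos: "AE x in lebesgue. 0 < v x"
  using v by (auto simp: weight_def)

lemma dual_weights:
  obtains A where "dual_weights w \<sigma> \<tau> A"
proof -
  let ?S = "SUP Q\<in>cubes. mean Q (\<lambda>x. ennreal (v x powr p)) *
      ennpowr (mean Q (\<lambda>x. ennreal ((v x powr p) powr (- (1 / \<tau>))))) \<tau>"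
  have "?S < top" using muckenhoupt by (simp add: muckenhoupt_def \<tau>_def)
  then obtain A where A: "?S = ennreal A" "0 \<le> A" by (cases ?S) auto
  show ?thesis
  proof (rule that[of A], unfold_locales)
    show "AE x in lebesgue. w x * ennpowr (\<sigma> x) \<tau> = 1"
      using v_pos
    proof eventually_elim
      case (elim x)
      have "v x powr p * (v x powr (- (p / \<tau>))) powr \<tau> = 1"
        using elim \<tau>_pos by (simp add: powr_powr powr_add[symmetric])
      then show ?case
        by (simp add: w_def \<sigma>_def ennpowr_ennreal ennreal_mult[symmetric])
    qed
  next
    fix c :: 'a and \<rho> :: real assume "0 < \<rho>"
    then have "mean (qcube c \<rho>) (\<lambda>x. ennreal (v x powr p)) *
      ennpowr (mean (qcube c \<rho>) (\<lambda>x. ennreal ((v x powr p) powr (- (1 / \<tau>))))) \<tau> \<le> ?S"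
      by (intro SUP_upper qcube_in_cubes)
    then show "mean (qcube c \<rho>) w * ennpowr (mean (qcube c \<rho>) \<sigma>) \<tau> \<le> ennreal A"
      unfolding A by (simp add: w_def[abs_def] \<sigma>_def[abs_def] powr_powr)
  next
    show "w \<in> borel_measurable lebesgue" "\<sigma> \<in> borel_measurable lebesgue"
      unfolding w_def[abs_def] \<sigma>_def[abs_def] by measurable
  qed (use A \<tau>_pos in auto)
qed

text \<open>Let \<open>g = v M\<^sub>r(b/v)\<close> for a block \<open>b\<close> on \<open>Q\<close>, and let \<open>F = \<bar>b/v\<bar>\<^sup>r\<close> and \<open>u = p/r\<close>, so that \<open>w F\<^sup>u = \<bar>b\<bar>\<^sup>p\<close> and
  \<open>g\<^sup>p = w (M F)\<^sup>u\<close>. On \<open>3Q\<close> Muckenhoupt's theorem bounds the integral of \<open>g\<^sup>p\<close> by a multiple of that of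
  \<open>\<bar>b\<bar>\<^sup>p\<close>. On the annulus inside \<open>R = 3\<^sup>k\<^sup>+\<^sup>1Q\<close> the function \<open>M F\<close> is at most \<open>9\<^sup>d/\<bar>R\<bar>\<close> times the integral of \<open>F\<close>. The
  \<open>u\<close>-th power of that integral is at most \<open>\<sigma>(Q)\<^sup>\<tau>\<close>: the volume of \<open>Q\<close> enters with the powers \<open>1 - p/q\<close>, from
  the normalization of the block, and \<open>u - 1 - \<tau> = p/q - 1\<close>, which cancel. Since \<open>\<sigma>(Q)\<close> is at most
  \<open>\<theta>\<^sup>k\<^sup>+\<^sup>1 \<sigma>(R)\<close> and \<open>w(R) \<sigma>(R)\<^sup>\<tau>\<close> is at most \<open>A \<bar>R\<bar>\<^sup>1\<^sup>+\<^sup>\<tau>\<close>, the integral of \<open>g\<^sup>p\<close> is at most a constant times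
  \<open>\<theta>\<^sup>\<tau>\<^sup>k \<bar>R\<bar>\<^sup>1\<^sup>-\<^sup>p\<^sup>/\<^sup>q\<close>. The \<open>A\<^sub>t\<close> condition alone would give this without the decaying factor.\<close>

lemma annulus_bounds:
  obtains B \<theta> where "0 < B" "0 < \<theta>" "\<theta> < 1"
    "\<And>b c \<rho> k. b \<in> borel_measurable lebesgue \<Longrightarrow> 0 < \<rho> \<Longrightarrow>
      (AE x in lebesgue. x \<notin> qcube c \<rho> \<longrightarrow> b x = 0) \<Longrightarrow>
      (\<integral>\<^sup>+x. ennreal (norm (b x) powr p) \<partial>lebesgue) \<le> ennreal (((2 * \<rho>) ^ DIM('a)) powr (1 - p / q)) \<Longrightarrow>
      (\<integral>\<^sup>+x. ennpowr (ennreal (v x) * maximal r (\<lambda>x. b x / of_real (v x)) x) p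
          * indicator (qcube c (3 ^ Suc k * \<rho>) - (if k = 0 then {} else qcube c (3 ^ k * \<rho>))) x \<partial>lebesgue)
        \<le> ennreal (B * \<theta> ^ k * ((2 * (3 ^ Suc k * \<rho>)) ^ DIM('a)) powr (1 - p / q))"
proof -
  obtain A where dw: "dual_weights w \<sigma> \<tau> A" by (rule dual_weights)
  interpret W: dual_weights w \<sigma> \<tau> A by (rule dw)
  interpret S: dual_weights \<sigma> w "1 / \<tau>" "A powr (1 / \<tau>)" by (rule W.swap)
  let ?u = "p / r" and ?d = "DIM('a)"
  have u: "1 + (?u - 1) = ?u" "0 < ?u" using p r by auto
  interpret M: dual_weights w "\<lambda>x. ennpowr (\<sigma> x) (\<tau> / (?u - 1))" "?u - 1" A
    using \<tau>_le by (intro W.dual_weights_mono) auto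
  obtain \<D> :: "('a \<times> real) set" where \<D>: "countable \<D>"
    "\<And>c \<rho>. (c, \<rho>) \<in> \<D> \<Longrightarrow> 0 < \<rho>"
    "\<And>c \<rho> \<epsilon>. 0 < \<rho> \<Longrightarrow> 0 < \<epsilon> \<Longrightarrow>
      \<exists>c' \<rho>'. (c', \<rho>') \<in> \<D> \<and> qcube c \<rho> \<subseteq> qcube c' \<rho>' \<and> \<rho>' \<le> \<rho> + \<epsilon>"
    by (rule countable_qcube_family) blast
  have "\<exists>C\<ge>0. \<forall>F\<in>borel_measurable lebesgue.
      (\<integral>\<^sup>+x. w x * ennpowr (maxop \<D> lebesgue F x) (1 + (?u - 1)) \<partial>lebesgue)
        \<le> ennreal C * (\<integral>\<^sup>+x. w x * ennpowr (F x) (1 + (?u - 1)) \<partial>lebesgue)"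
    by (rule M.Muckenhoupt; fact \<D>)
  then obtain C where C: "0 \<le> C" and strong: "\<And>F. F \<in> borel_measurable lebesgue \<Longrightarrow>
      (\<integral>\<^sup>+x. w x * ennpowr (maxop \<D> lebesgue F x) ?u \<partial>lebesgue)
        \<le> ennreal C * (\<integral>\<^sup>+x. w x * ennpowr (F x) ?u \<partial>lebesgue)"
    unfolding u(1) by blast
  obtain \<theta> where \<theta>: "0 < \<theta>" "\<theta> < 1"
    and decay: "\<And>k c \<rho>. 0 < \<rho> \<Longrightarrow> W.wt \<sigma> (qcube c \<rho>) \<le> ennreal (\<theta> ^ k) * W.wt \<sigma> (qcube c (3 ^ k * \<rho>))"
    by (rule S.wt_reverse_doubling) blast
  \<comment> \<open>The constant of \<open>3Q\<close>, the constant of the other annuli, and 1 to make the sum positive.\<close>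
  define B where "B = C * (3 ^ ?d) powr (p / q - 1) + (9 ^ ?d) powr ?u * A + 1"
  have B: "0 < B" "C * (3 ^ ?d) powr (p / q - 1) \<le> B" "(9 ^ ?d) powr ?u * A \<le> B"
    using C W.A by (auto simp: B_def add_nonneg_pos)
  show ?thesis
  proof (rule that[of B "\<theta> powr \<tau>"])
    show "0 < B" by (rule B)
    show "0 < \<theta> powr \<tau>" using \<theta> by simp
    have "\<theta> powr \<tau> < 1 powr \<tau>" using \<theta> \<tau>_pos by (intro powr_less_mono2) auto
    then show "\<theta> powr \<tau> < 1" by simp
    fix b :: "'a \<Rightarrow> complex" and c :: 'a and \<rho> :: real and k :: nat
    assume b [measurable]: "b \<in> borel_measurable lebesgue" and \<rho>: "0 < \<rho>"
      and supp: "AE x in lebesgue. x \<notin> qcube c \<rho> \<longrightarrow> b x = 0"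
      and int: "(\<integral>\<^sup>+x. ennreal (norm (b x) powr p) \<partial>lebesgue) \<le> ennreal (((2 * \<rho>) ^ ?d) powr (1 - p / q))"
    define F where "F x = ennreal (norm (b x / of_real (v x)) powr r)" for x
    have F [measurable]: "F \<in> borel_measurable lebesgue" unfolding F_def by measurable
    define g where "g x = ennreal (v x) * maximal r (\<lambda>x. b x / of_real (v x)) x" for x
    define R where "R = qcube c (3 ^ Suc k * \<rho>)"
    define E where "E = R - (if k = 0 then {} else qcube c (3 ^ k * \<rho>))"
    define V where "V = (2 * \<rho>) ^ ?d"
    define Vk where "Vk = (2 * (3 ^ Suc k * \<rho>)) ^ ?d"
    have pos: "0 < V" "0 < Vk" using \<rho> by (auto simp: V_def Vk_def)
    have vol: "emeasure lebesgue (qcube c \<rho>) = ennreal V" "emeasure lebesgue R = ennreal Vk"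
      unfolding R_def V_def Vk_def by (rule emeasure_qcube; use \<rho> in simp)+
    have [measurable]: "R \<in> sets lebesgue" "E \<in> sets lebesgue" by (auto simp: R_def E_def)
    have [measurable]: "maxop \<D> lebesgue F \<in> borel_measurable lebesgue"
      using measurable_maxop[OF \<D>(1), of lebesgue F] by simp
    have wF: "AE x in lebesgue. w x * ennpowr (F x) ?u = ennreal (norm (b x) powr p)"
      using v_pos
    proof eventually_elim
      case (elim x)
      have "w x * ennpowr (F x) ?u = ennreal (v x powr p * (norm (b x) / v x) powr p)"
        using elim p r by (simp add: w_def F_def ennpowr_ennreal powr_powr ennreal_mult norm_divide)
      also have "v x powr p * (norm (b x) / v x) powr p = norm (b x) powr p"
        using elim by (simp add: powr_divide)
      finally show ?case .
    qed
    have intwF: "(\<integral>\<^sup>+x. w x * ennpowr (F x) ?u \<partial>lebesgue) \<le> ennreal (V powr (1 - p / q))"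
      using int nn_integral_cong_AE[OF wF] by (simp add: V_def)
    have gp: "AE x in lebesgue. ennpowr (g x) p = w x * ennpowr (maxop \<D> lebesgue F x) ?u"
      using v_pos
    proof eventually_elim
      case (elim x)
      have "maximal r (\<lambda>x. b x / of_real (v x)) x = ennpowr (maxop \<D> lebesgue F x) (1 / r)"
        unfolding F_def[abs_def]
        by (rule maximal_eq_maxop; (fact \<D>)?) (use r in simp)
      then show ?case
        using elim by (simp add: g_def ennpowr_mult ennpowr_ennpowr ennpowr_ennreal w_def)
    qed
    have main: "(\<integral>\<^sup>+x\<in>E. w x * ennpowr (maxop \<D> lebesgue F x) ?u \<partial>lebesgue)
        \<le> ennreal (B * (\<theta> powr \<tau>) ^ k * Vk powr (1 - p / q))"
    proof (cases "k = 0")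
      case True
      have "(\<integral>\<^sup>+x\<in>E. w x * ennpowr (maxop \<D> lebesgue F x) ?u \<partial>lebesgue)
          \<le> (\<integral>\<^sup>+x. w x * ennpowr (maxop \<D> lebesgue F x) ?u \<partial>lebesgue)"
        by (intro nn_integral_mono) (auto simp: indicator_def)
      also have "\<dots> \<le> ennreal C * (\<integral>\<^sup>+x. w x * ennpowr (F x) ?u \<partial>lebesgue)"
        by (rule strong) measurable
      also have "\<dots> \<le> ennreal C * ennreal (V powr (1 - p / q))"
        by (intro mult_left_mono intwF) auto
      also have "\<dots> = ennreal (C * V powr (1 - p / q))" using C by (simp add: ennreal_mult)
      also have "C * V powr (1 - p / q) = C * (3 ^ ?d) powr (p / q - 1) * Vk powr (1 - p / q)"
      proof -
        have "Vk = 3 ^ ?d * V"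
          using True power_mult_distrib[of 3 "2 * \<rho>" ?d] by (simp add: Vk_def V_def mult.left_commute del: power_mult_distrib)
        then have "Vk powr (1 - p / q) = (3 ^ ?d) powr (1 - p / q) * V powr (1 - p / q)"
          using pos by (simp add: powr_mult)
        moreover have "(3 ^ ?d) powr (p / q - 1) * (3 ^ ?d) powr (1 - p / q) = (1::real)"
          by (simp add: powr_add[symmetric])
        ultimately show ?thesis by (metis mult.assoc mult.right_neutral)
      qed
      also have "\<dots> \<le> B * Vk powr (1 - p / q)" by (intro mult_right_mono B) auto
      finally show ?thesis using True by (simp add: ennreal_leI)
    next
      case False
      let ?N = "ennreal (9 ^ ?d / Vk) * W.wt F (qcube c \<rho>)"
      have suppF: "AE x in lebesgue. x \<notin> qcube c \<rho> \<longrightarrow> F x = 0"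
        using supp by eventually_elim (auto simp: F_def)
      have k3: "3 * \<rho> \<le> 3 ^ k * \<rho>"
        using \<rho> False power_increasing[of 1 k "3::real"] by simp
      have "(\<integral>\<^sup>+x\<in>E. w x * ennpowr (maxop \<D> lebesgue F x) ?u \<partial>lebesgue)
          \<le> (\<integral>\<^sup>+x. ennpowr ?N ?u * (w x * indicator R x) \<partial>lebesgue)"
      proof (rule nn_integral_mono)
        fix x
        show "w x * ennpowr (maxop \<D> lebesgue F x) ?u * indicator E x \<le> ennpowr ?N ?u * (w x * indicator R x)"
        proof (cases "x \<in> E")
          case True
          then have x: "x \<in> R" "x \<notin> qcube c (3 ^ k * \<rho>)" using False by (auto simp: E_def)
          have "maxop \<D> lebesgue F x \<le> ?N"
            unfolding Vk_def power_Suc mult.assoc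
            by (rule maxop_far_le; fact \<D> \<rho> k3 x suppF)
          then have "ennpowr (maxop \<D> lebesgue F x) ?u \<le> ennpowr ?N ?u"
            using u by (intro ennpowr_mono) auto
          then show ?thesis using True x by (simp add: mult.commute mult_left_mono)
        qed simp
      qed
      also have "\<dots> = ennpowr ?N ?u * W.wt w R"
        by (rule nn_integral_cmult) measurable
      also have "\<dots> = ennreal ((9 ^ ?d / Vk) powr ?u) * (ennpowr (W.wt F (qcube c \<rho>)) ?u * W.wt w R)"
        using pos by (simp add: ennpowr_mult ennpowr_ennreal mult.assoc)
      also have "\<dots> \<le> ennreal ((9 ^ ?d / Vk) powr ?u) * (ennpowr (W.wt \<sigma> (qcube c \<rho>)) \<tau> * W.wt w R)"
      proof (intro mult_left_mono mult_right_mono)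
        have "ennpowr (W.wt F (qcube c \<rho>)) ?u \<le> W.wt (\<lambda>x. w x * ennpowr (F x) ?u) (qcube c \<rho>)
            * ennpowr (emeasure lebesgue (qcube c \<rho>)) (?u - 1 - \<tau>) * ennpowr (W.wt \<sigma> (qcube c \<rho>)) \<tau>"
          using \<tau>_le by (intro W.nn_integral_le_dual \<rho>) auto
        also have "\<dots> \<le> ennreal (V powr (1 - p / q)) * ennreal (V powr (p / q - 1)) * ennpowr (W.wt \<sigma> (qcube c \<rho>)) \<tau>"
        proof (intro mult_right_mono mult_mono)
          have "W.wt (\<lambda>x. w x * ennpowr (F x) ?u) (qcube c \<rho>) \<le> (\<integral>\<^sup>+x. w x * ennpowr (F x) ?u \<partial>lebesgue)"
            by (intro nn_integral_mono) (auto simp: indicator_def)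
          also note intwF
          finally show "W.wt (\<lambda>x. w x * ennpowr (F x) ?u) (qcube c \<rho>) \<le> ennreal (V powr (1 - p / q))" .
          have "?u - 1 - \<tau> = p / q - 1" by (simp add: \<tau>_def right_diff_distrib)
          then have "ennpowr (emeasure lebesgue (qcube c \<rho>)) (?u - 1 - \<tau>) = ennreal (V powr (p / q - 1))"
            using pos by (simp only: vol ennpowr_ennreal less_imp_le)
          then show "ennpowr (emeasure lebesgue (qcube c \<rho>)) (?u - 1 - \<tau>) \<le> ennreal (V powr (p / q - 1))"
            by simp
        qed auto
        also have "ennreal (V powr (1 - p / q)) * ennreal (V powr (p / q - 1)) = 1"
          using pos by (simp add: ennreal_mult[symmetric] powr_add[symmetric])
        finally show "ennpowr (W.wt F (qcube c \<rho>)) ?u \<le> ennpowr (W.wt \<sigma> (qcube c \<rho>)) \<tau>" by simp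
      qed auto
      also have "\<dots> \<le> ennreal ((9 ^ ?d / Vk) powr ?u) * (ennpowr (ennreal (\<theta> ^ Suc k) * W.wt \<sigma> R) \<tau> * W.wt w R)"
        unfolding R_def using \<tau>_pos
        by (intro mult_left_mono mult_right_mono ennpowr_mono decay \<rho>) auto
      also have "\<dots> = ennreal ((9 ^ ?d / Vk) powr ?u) * (ennreal ((\<theta> ^ Suc k) powr \<tau>) * (W.wt w R * ennpowr (W.wt \<sigma> R) \<tau>))"
        using \<theta> by (simp only: ennpowr_mult ennpowr_ennreal zero_le_power less_imp_le ac_simps)
      also have "\<dots> \<le> ennreal ((9 ^ ?d / Vk) powr ?u) * (ennreal ((\<theta> ^ Suc k) powr \<tau>) * (ennreal A * ennreal (Vk powr (1 + \<tau>))))"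
      proof (intro mult_left_mono)
        have "0 < 3 ^ Suc k * \<rho>" using \<rho> by simp
        from W.wt_product_le[OF this, of c, folded R_def]
        show "W.wt w R * ennpowr (W.wt \<sigma> R) \<tau> \<le> ennreal A * ennreal (Vk powr (1 + \<tau>))"
          using pos by (simp only: vol ennpowr_ennreal less_imp_le)
      qed auto
      also have "\<dots> = ennreal ((9 ^ ?d / Vk) powr ?u * ((\<theta> ^ Suc k) powr \<tau> * (A * Vk powr (1 + \<tau>))))"
        using W.A \<theta> by (simp add: ennreal_mult)
      also have "(9 ^ ?d / Vk) powr ?u * ((\<theta> ^ Suc k) powr \<tau> * (A * Vk powr (1 + \<tau>)))
          = ((9 ^ ?d) powr ?u * A) * (\<theta> ^ Suc k) powr \<tau> * Vk powr (1 - p / q)"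
      proof -
        have "Vk powr (1 - p / q) = Vk powr (1 + \<tau>) / Vk powr ?u"
          by (simp add: powr_diff[symmetric] \<tau>_def right_diff_distrib)
        moreover have "(9 ^ ?d / Vk) powr ?u = (9 ^ ?d) powr ?u / Vk powr ?u"
          by (rule powr_divide)
        ultimately show ?thesis by simp
      qed
      also have "\<dots> \<le> B * (\<theta> powr \<tau>) ^ k * Vk powr (1 - p / q)"
      proof (intro mult_right_mono mult_mono B)
        have "(\<theta> ^ Suc k) powr \<tau> \<le> (\<theta> ^ k) powr \<tau>"
          using \<theta> \<tau>_pos by (intro powr_mono2 power_decreasing) auto
        also have "\<dots> = (\<theta> powr \<tau>) ^ k"
          using \<theta> by (simp add: powr_realpow[symmetric] powr_powr mult.commute)
        finally show "(\<theta> ^ Suc k) powr \<tau> \<le> (\<theta> powr \<tau>) ^ k" .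
      qed (use B in auto)
      finally show ?thesis by (simp add: ennreal_leI)
    qed
    have "(\<integral>\<^sup>+x. ennpowr (g x) p * indicator E x \<partial>lebesgue)
        = (\<integral>\<^sup>+x\<in>E. w x * ennpowr (maxop \<D> lebesgue F x) ?u \<partial>lebesgue)"
      using gp by (intro nn_integral_cong_AE) (auto elim!: eventually_mono)
    with main show "(\<integral>\<^sup>+x. ennpowr (ennreal (v x) * maximal r (\<lambda>x. b x / of_real (v x)) x) p
          * indicator (qcube c (3 ^ Suc k * \<rho>) - (if k = 0 then {} else qcube c (3 ^ k * \<rho>))) x \<partial>lebesgue)
        \<le> ennreal (B * (\<theta> powr \<tau>) ^ k * ((2 * (3 ^ Suc k * \<rho>)) ^ ?d) powr (1 - p / q))"
      unfolding g_def E_def R_def Vk_def by simp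
  qed
qed

text \<open>Divided by \<open>K \<eta>\<^sup>k\<close>, the \<open>p\<close>-th root of the constant in the bound on the \<open>k\<close>-th annulus, the piece of
  \<open>v M\<^sub>r(b/v)\<close> on that annulus is itself a block.\<close>

lemma maximal_block_le_block_series:
  obtains K \<eta> where "0 < K" "0 < \<eta>" "\<eta> < 1"
    "\<And>b. is_block p q b \<Longrightarrow> \<exists>\<beta> :: nat \<Rightarrow> 'a \<Rightarrow> real. (\<forall>k x. 0 \<le> \<beta> k x) \<and>
      (\<forall>k. is_block p q (\<lambda>x. complex_of_real (\<beta> k x))) \<and>
      (AE x in lebesgue. ennreal (v x) * maximal r (\<lambda>x. b x / of_real (v x)) x
        \<le> (\<Sum>k. ennreal (K * \<eta> ^ k) * ennreal (\<beta> k x)))"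
proof -
  obtain B \<theta> where B: "0 < B" "0 < \<theta>" "\<theta> < 1"
    and bound: "\<And>b c \<rho> k. b \<in> borel_measurable lebesgue \<Longrightarrow> 0 < \<rho> \<Longrightarrow>
      (AE x in lebesgue. x \<notin> qcube c \<rho> \<longrightarrow> b x = 0) \<Longrightarrow>
      (\<integral>\<^sup>+x. ennreal (norm (b x) powr p) \<partial>lebesgue) \<le> ennreal (((2 * \<rho>) ^ DIM('a)) powr (1 - p / q)) \<Longrightarrow>
      (\<integral>\<^sup>+x. ennpowr (ennreal (v x) * maximal r (\<lambda>x. b x / of_real (v x)) x) p
          * indicator (qcube c (3 ^ Suc k * \<rho>) - (if k = 0 then {} else qcube c (3 ^ k * \<rho>))) x \<partial>lebesgue)
        \<le> ennreal (B * \<theta> ^ k * ((2 * (3 ^ Suc k * \<rho>)) ^ DIM('a)) powr (1 - p / q))"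
    by (rule annulus_bounds) blast
  define K where "K = B powr (1 / p)"
  define \<eta> where "\<eta> = \<theta> powr (1 / p)"
  have K: "0 < K" "0 < \<eta>" "\<eta> < 1"
  proof -
    have "\<theta> powr (1 / p) < 1 powr (1 / p)" using B p by (intro powr_less_mono2) auto
    then show "0 < K" "0 < \<eta>" "\<eta> < 1" using B by (auto simp: K_def \<eta>_def)
  qed
  have K\<eta>: "(K * \<eta> ^ k) powr p = B * \<theta> ^ k" for k
  proof -
    have "(\<eta> ^ k) powr p = (\<eta> powr p) ^ k"
      using K by (simp add: powr_realpow[symmetric] powr_powr mult.commute)
    then show ?thesis
      using B p K by (simp add: powr_mult) (simp add: K_def \<eta>_def powr_powr)
  qed
  show ?thesis
  proof (rule that[OF K])
    fix b :: "'a \<Rightarrow> complex" assume b: "is_block p q b"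
    have bm [measurable]: "b \<in> borel_measurable lebesgue" using b by (simp add: is_block_def)
    have "0 < p" using p by simp
    from is_blockE[OF b this] obtain c \<rho> where c: "0 < \<rho>"
      "AE x in lebesgue. x \<notin> qcube c \<rho> \<longrightarrow> b x = 0"
      "(\<integral>\<^sup>+x. ennreal (norm (b x) powr p) \<partial>lebesgue) \<le> ennreal (((2 * \<rho>) ^ DIM('a)) powr (1 - p / q))"
      by blast
    define g where "g x = ennreal (v x) * maximal r (\<lambda>x. b x / of_real (v x)) x" for x
    have "maximal r (\<lambda>x. b x / of_real (v x)) \<in> borel_measurable lebesgue"
      using r by (intro measurable_maximal) auto
    then have [measurable]: "g \<in> borel_measurable lebesgue" unfolding g_def by measurable
    define E where "E k = qcube c (3 ^ Suc k * \<rho>) - (if k = 0 then {} else qcube c (3 ^ k * \<rho>))" for k :: nat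
    have [measurable]: "E k \<in> sets lebesgue" for k by (auto simp: E_def)
    define V where "V k = (2 * (3 ^ Suc k * \<rho>)) ^ DIM('a)" for k :: nat
    have g: "(\<integral>\<^sup>+x. ennpowr (g x) p * indicator (E k) x \<partial>lebesgue) \<le> ennreal (B * \<theta> ^ k * V k powr (1 - p / q))" for k
      unfolding g_def E_def V_def by (rule bound[OF bm c])
    define \<beta> where "\<beta> k x = enn2real (g x) / (K * \<eta> ^ k) * indicator (E k) x" for k x
    have \<beta>0: "0 \<le> \<beta> k x" for k x using K by (simp add: \<beta>_def)
    have m\<beta>: "(\<lambda>x. complex_of_real (\<beta> k x)) \<in> borel_measurable lebesgue" for k
      unfolding \<beta>_def by measurable
    have block: "is_block p q (\<lambda>x. complex_of_real (\<beta> k x))" for k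
    proof (rule is_blockI[OF m\<beta> \<open>0 < p\<close>])
      show "0 < 3 ^ Suc k * \<rho>" using c by simp
      show "AE x in lebesgue. x \<notin> qcube c (3 ^ Suc k * \<rho>) \<longrightarrow> complex_of_real (\<beta> k x) = 0"
        by (auto simp: \<beta>_def E_def)
      have M: "0 < B * \<theta> ^ k" using B by simp
      have "(\<integral>\<^sup>+x. ennreal (norm (complex_of_real (\<beta> k x)) powr p) \<partial>lebesgue)
          \<le> (\<integral>\<^sup>+x. ennreal (1 / (B * \<theta> ^ k)) * (ennpowr (g x) p * indicator (E k) x) \<partial>lebesgue)"
      proof (rule nn_integral_mono)
        fix x
        show "ennreal (norm (complex_of_real (\<beta> k x)) powr p) \<le> ennreal (1 / (B * \<theta> ^ k)) * (ennpowr (g x) p * indicator (E k) x)"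
        proof (cases "x \<in> E k \<and> g x \<noteq> top")
          case True
          then obtain y where y: "g x = ennreal y" "0 \<le> y" by (cases "g x") auto
          have "norm (complex_of_real (\<beta> k x)) = y / (K * \<eta> ^ k)"
            unfolding norm_of_real abs_of_nonneg[OF \<beta>0] using True y by (simp add: \<beta>_def)
          then have "norm (complex_of_real (\<beta> k x)) powr p = (y / (K * \<eta> ^ k)) powr p" by simp
          also have "\<dots> = 1 / (B * \<theta> ^ k) * y powr p"
            using y K by (simp add: powr_divide K\<eta>[symmetric])
          finally show ?thesis
            using True y M by (simp add: ennpowr_ennreal ennreal_mult'[symmetric])
        next
          case False
          then have "\<beta> k x = 0" by (auto simp: \<beta>_def)
          then show ?thesis by simp
        qed
      qed
      also have "\<dots> = ennreal (1 / (B * \<theta> ^ k)) * (\<integral>\<^sup>+x. ennpowr (g x) p * indicator (E k) x \<partial>lebesgue)"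
        by (rule nn_integral_cmult) measurable
      also have "\<dots> \<le> ennreal (1 / (B * \<theta> ^ k)) * ennreal (B * \<theta> ^ k * V k powr (1 - p / q))"
        by (intro mult_left_mono g) auto
      also have "\<dots> = ennreal (V k powr (1 - p / q))"
        using M B by (simp add: ennreal_mult[symmetric])
      finally show "(\<integral>\<^sup>+x. ennreal (norm (complex_of_real (\<beta> k x)) powr p) \<partial>lebesgue)
          \<le> ennreal (((2 * (3 ^ Suc k * \<rho>)) ^ DIM('a)) powr (1 - p / q))" by (simp add: V_def)
    qed
    have fin: "AE x in lebesgue. x \<in> E k \<longrightarrow> g x \<noteq> top" for k
    proof -
      have "(\<integral>\<^sup>+x. ennpowr (g x) p * indicator (E k) x \<partial>lebesgue) < top"
        using g[of k] by (rule le_less_trans) simp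
      then have "AE x in lebesgue. ennpowr (g x) p * indicator (E k) x \<noteq> top"
        by (intro nn_integral_PInf_AE[unfolded infinity_ennreal_def]) (auto simp: less_top)
      then show ?thesis by eventually_elim auto
    qed
    have cover: "\<exists>k. x \<in> E k" for x
    proof -
      obtain n :: nat where n: "norm (x - c) / \<rho> < 3 ^ n"
        using real_arch_pow[of 3 "norm (x - c) / \<rho>"] by auto
      have "x \<in> qcube c (3 ^ Suc n * \<rho>)"
        unfolding mem_qcube
      proof
        fix i :: 'a assume "i \<in> Basis"
        then have "\<bar>(x - c) \<bullet> i\<bar> \<le> norm (x - c)" by (rule Basis_le_norm)
        also have "\<dots> \<le> 3 ^ n * \<rho>" using n c by (simp add: field_simps)
        also have "\<dots> \<le> 3 ^ Suc n * \<rho>" using c by simp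
        finally show "\<bar>x \<bullet> i - c \<bullet> i\<bar> \<le> 3 ^ Suc n * \<rho>" by (simp add: inner_diff_left)
      qed
      then have ex: "\<exists>n. x \<in> qcube c (3 ^ Suc n * \<rho>)" by blast
      define k where "k = (LEAST n. x \<in> qcube c (3 ^ Suc n * \<rho>))"
      have k: "x \<in> qcube c (3 ^ Suc k * \<rho>)" unfolding k_def by (rule LeastI_ex[OF ex])
      have "x \<notin> qcube c (3 ^ k * \<rho>)" if "k \<noteq> 0"
      proof
        assume x: "x \<in> qcube c (3 ^ k * \<rho>)"
        obtain j where j: "k = Suc j" using \<open>k \<noteq> 0\<close> by (cases k) auto
        have "k \<le> j" unfolding k_def by (rule Least_le) (use x j in simp)
        with j show False by simp
      qed
      with k show ?thesis by (intro exI[of _ k]) (auto simp: E_def)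
    qed
    have "AE x in lebesgue. \<forall>k. x \<in> E k \<longrightarrow> g x \<noteq> top"
      unfolding AE_all_countable by (intro allI fin)
    then have "AE x in lebesgue. g x \<le> (\<Sum>k. ennreal (K * \<eta> ^ k) * ennreal (\<beta> k x))"
    proof eventually_elim
      case (elim x)
      obtain k where k: "x \<in> E k" using cover by blast
      with elim obtain y where y: "g x = ennreal y" "0 \<le> y" by (cases "g x") auto
      have "K * \<eta> ^ k * \<beta> k x = y" using k y K by (simp add: \<beta>_def)
      then have "g x = ennreal (K * \<eta> ^ k) * ennreal (\<beta> k x)"
        using K \<beta>0[of k x] y by (simp add: ennreal_mult[symmetric])
      also have "\<dots> \<le> (\<Sum>k. ennreal (K * \<eta> ^ k) * ennreal (\<beta> k x))"
        using sum_le_suminf[of "\<lambda>k. ennreal (K * \<eta> ^ k) * ennreal (\<beta> k x)" "{k}"] by simp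
      finally show ?case .
    qed
    then show "\<exists>\<beta> :: nat \<Rightarrow> 'a \<Rightarrow> real. (\<forall>k x. 0 \<le> \<beta> k x) \<and>
      (\<forall>k. is_block p q (\<lambda>x. complex_of_real (\<beta> k x))) \<and>
      (AE x in lebesgue. ennreal (v x) * maximal r (\<lambda>x. b x / of_real (v x)) x
        \<le> (\<Sum>k. ennreal (K * \<eta> ^ k) * ennreal (\<beta> k x)))"
      using \<beta>0 block by (intro exI[of _ \<beta>]) (simp add: g_def)
  qed
qed

text \<open>Sublinearity reduces the claim to the single blocks of a representation of \<open>f v\<close>, each of which
  is majorized by a geometric series of blocks. The double series, enumerated as one series, majorizes
  \<open>v M\<^sub>r f\<close>, and the ideal property turns it into a representation.\<close>

lemma maximal_block_representation:
  obtains C where "0 < C"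
    "\<And>f c b. block_representation p q (\<lambda>x. f x * of_real (v x)) c b \<Longrightarrow>
      (AE x in lebesgue. maximal r f x < top) \<and>
      (\<exists>c' b'. block_representation p q
          (\<lambda>x. complex_of_real (enn2real (maximal r f x)) * of_real (v x)) c' b' \<and>
        (\<Sum>n. norm (c' n)) = C * (\<Sum>n. norm (c n)))"
proof -
  obtain K \<eta> where K: "0 < K" "0 < \<eta>" "\<eta> < 1"
    and dec: "\<And>b. is_block p q b \<Longrightarrow> \<exists>\<beta> :: nat \<Rightarrow> 'a \<Rightarrow> real. (\<forall>k x. 0 \<le> \<beta> k x) \<and>
      (\<forall>k. is_block p q (\<lambda>x. complex_of_real (\<beta> k x))) \<and>
      (AE x in lebesgue. ennreal (v x) * maximal r (\<lambda>x. b x / of_real (v x)) x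
        \<le> (\<Sum>k. ennreal (K * \<eta> ^ k) * ennreal (\<beta> k x)))"
    by (rule maximal_block_le_block_series) blast
  define C where "C = K / (1 - \<eta>)"
  have C: "0 < C" using K by (simp add: C_def)
  have geo: "(\<Sum>k. ennreal (K * \<eta> ^ k)) = ennreal C"
  proof -
    have "(\<lambda>k. K * \<eta> ^ k) sums (K * (1 / (1 - \<eta>)))"
      using K by (intro sums_mult geometric_sums) auto
    then have "(\<Sum>k. ennreal (K * \<eta> ^ k)) = ennreal (K * (1 / (1 - \<eta>)))"
      using K by (intro suminf_ennreal_eq) auto
    then show ?thesis by (simp add: C_def)
  qed
  show ?thesis
  proof (rule that[OF C])
    fix f :: "'a \<Rightarrow> complex" and c b
    assume rep: "block_representation p q (\<lambda>x. f x * of_real (v x)) c b"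
    then have c: "summable (\<lambda>n. norm (c n))" and b: "\<And>n. is_block p q (b n)"
      and f: "AE x in lebesgue. (\<lambda>n. c n * b n x) sums (f x * of_real (v x))"
      by (auto simp: block_representation_def)
    have [measurable]: "b n \<in> borel_measurable lebesgue" for n using b by (simp add: is_block_def)
    let ?a = "\<lambda>n x. b n x / of_real (v x)"
    obtain \<beta> :: "nat \<Rightarrow> nat \<Rightarrow> 'a \<Rightarrow> real" where \<beta>: "\<And>n k x. 0 \<le> \<beta> n k x"
      "\<And>n k. is_block p q (\<lambda>x. complex_of_real (\<beta> n k x))"
      "\<And>n. AE x in lebesgue. ennreal (v x) * maximal r (?a n) x
        \<le> (\<Sum>k. ennreal (K * \<eta> ^ k) * ennreal (\<beta> n k x))"
    proof -
      have "\<forall>n. \<exists>\<beta> :: nat \<Rightarrow> 'a \<Rightarrow> real. (\<forall>k x. 0 \<le> \<beta> k x) \<and>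
        (\<forall>k. is_block p q (\<lambda>x. complex_of_real (\<beta> k x))) \<and>
        (AE x in lebesgue. ennreal (v x) * maximal r (?a n) x
          \<le> (\<Sum>k. ennreal (K * \<eta> ^ k) * ennreal (\<beta> k x)))"
        by (intro allI dec b)
      from choice[OF this] show ?thesis using that by blast
    qed
    have "AE x in lebesgue. (\<lambda>n. c n * ?a n x) sums f x"
      using f v_pos
    proof eventually_elim
      case (elim x)
      have "(\<lambda>n. c n * b n x / of_real (v x)) sums (f x * of_real (v x) / of_real (v x))"
        by (rule sums_divide[OF elim(1)])
      then show ?case using elim(2) by simp
    qed
    then have sub: "maximal r f x \<le> (\<Sum>n. ennreal (norm (c n)) * maximal r (?a n) x)" for x
      by (intro maximal_suminf_le r) measurable
    define g where "g x = ennreal (v x) * maximal r f x" for x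
    have "maximal r f \<in> borel_measurable lebesgue" using r by (intro measurable_maximal) auto
    then have [measurable]: "g \<in> borel_measurable lebesgue" unfolding g_def by measurable
    define \<mu> where "\<mu> m = (case prod_decode m of (n, k) \<Rightarrow> norm (c n) * (K * \<eta> ^ k))" for m
    define \<beta>' where "\<beta>' m = (case prod_decode m of (n, k) \<Rightarrow> \<beta> n k)" for m
    have \<mu>0: "0 \<le> \<mu> m" for m using K by (auto simp: \<mu>_def split: prod.split)
    have "(\<Sum>m. ennreal (\<mu> m)) = (\<Sum>n. ennreal (norm (c n)) * ennreal C)"
    proof -
      have "(\<Sum>m. (\<lambda>(n, k). ennreal (norm (c n) * (K * \<eta> ^ k))) (prod_decode m))
          = (\<Sum>n. ennreal (norm (c n)) * ennreal C)"
      proof (intro suminf_ennreal_2dimen)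
        fix n
        have "(\<Sum>k. ennreal (norm (c n) * (K * \<eta> ^ k))) = (\<Sum>k. ennreal (norm (c n)) * ennreal (K * \<eta> ^ k))"
          using K by (intro suminf_cong ennreal_mult) auto
        then show "ennreal (norm (c n)) * ennreal C
            = (\<Sum>k. (\<lambda>(n, k). ennreal (norm (c n) * (K * \<eta> ^ k))) (n, k))"
          by (simp only: ennreal_suminf_cmult geo prod.case)
      qed
      then show ?thesis by (simp add: \<mu>_def split_def)
    qed
    also have "\<dots> = ennreal (C * (\<Sum>n. norm (c n)))"
      using c C by (simp add: suminf_ennreal2 ennreal_mult suminf_nonneg mult.commute)
    finally have sum\<mu>: "(\<Sum>m. ennreal (\<mu> m)) = ennreal (C * (\<Sum>n. norm (c n)))" .
    then have sm: "summable \<mu>" using \<mu>0 by (intro summable_suminf_not_top) auto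
    have total: "(\<Sum>m. \<mu> m) = C * (\<Sum>n. norm (c n))"
    proof -
      have "ennreal (\<Sum>m. \<mu> m) = ennreal (C * (\<Sum>n. norm (c n)))"
        using sum\<mu> sm \<mu>0 by (simp add: suminf_ennreal2)
      then show ?thesis
        using sm \<mu>0 c C by (subst (asm) ennreal_inj) (auto intro!: suminf_nonneg mult_nonneg_nonneg)
    qed
    have "AE x in lebesgue. \<forall>n. ennreal (v x) * maximal r (?a n) x
        \<le> (\<Sum>k. ennreal (K * \<eta> ^ k) * ennreal (\<beta> n k x))"
      unfolding AE_all_countable by (intro allI \<beta>(3))
    then have le: "AE x in lebesgue. g x \<le> (\<Sum>m. ennreal (\<mu> m) * ennreal (\<beta>' m x))"
    proof eventually_elim
      case (elim x)
      have "g x \<le> ennreal (v x) * (\<Sum>n. ennreal (norm (c n)) * maximal r (?a n) x)"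
        unfolding g_def by (intro mult_left_mono sub) auto
      also have "\<dots> = (\<Sum>n. ennreal (norm (c n)) * (ennreal (v x) * maximal r (?a n) x))"
        by (simp add: mult.left_commute flip: ennreal_suminf_cmult)
      also have "\<dots> \<le> (\<Sum>n. ennreal (norm (c n)) * (\<Sum>k. ennreal (K * \<eta> ^ k) * ennreal (\<beta> n k x)))"
        using elim by (intro suminf_le mult_left_mono) auto
      also have "\<dots> = (\<Sum>m. (\<lambda>(n, k). ennreal (norm (c n)) * (ennreal (K * \<eta> ^ k) * ennreal (\<beta> n k x))) (prod_decode m))"
        by (intro suminf_ennreal_2dimen[symmetric]) simp
      also have "\<dots> = (\<Sum>m. ennreal (\<mu> m) * ennreal (\<beta>' m x))"
        using K by (intro suminf_cong) (auto simp: \<mu>_def \<beta>'_def ennreal_mult mult.assoc split: prod.split)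
      finally show ?case .
    qed
    have \<beta>': "0 \<le> \<beta>' m x" "is_block p q (\<lambda>x. complex_of_real (\<beta>' m x))" for m x
      using \<beta>(1,2) by (auto simp: \<beta>'_def split: prod.split)
    note maj = block_representation_of_majorant[OF q \<open>g \<in> borel_measurable lebesgue\<close> \<mu>0 sm \<beta>' le]
    have fin: "AE x in lebesgue. maximal r f x < top"
      using maj(1) v_pos
    proof eventually_elim
      case (elim x)
      then show ?case by (auto simp: g_def ennreal_mult_less_top)
    qed
    obtain b' where b': "block_representation p q (\<lambda>x. complex_of_real (enn2real (g x))) (\<lambda>n. complex_of_real (\<mu> n)) b'"
      using maj(2) by blast
    have "AE x in lebesgue. (\<lambda>n. complex_of_real (\<mu> n) * b' n x) sums
        (complex_of_real (enn2real (maximal r f x)) * of_real (v x))"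
      using b'[unfolded block_representation_def, THEN conjunct2, THEN conjunct2] v_pos
    proof eventually_elim
      case (elim x)
      have "complex_of_real (enn2real (g x)) = complex_of_real (enn2real (maximal r f x)) * of_real (v x)"
        using elim(2) by (simp add: g_def enn2real_mult mult.commute)
      with elim(1) show ?case by simp
    qed
    with b' have "block_representation p q
        (\<lambda>x. complex_of_real (enn2real (maximal r f x)) * of_real (v x)) (\<lambda>n. complex_of_real (\<mu> n)) b'"
      by (simp add: block_representation_def)
    moreover have "(\<Sum>n. norm (complex_of_real (\<mu> n))) = C * (\<Sum>n. norm (c n))"
      using \<mu>0 total by simp
    ultimately show "(AE x in lebesgue. maximal r f x < top) \<and>
      (\<exists>c' b'. block_representation p q
          (\<lambda>x. complex_of_real (enn2real (maximal r f x)) * of_real (v x)) c' b' \<and>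
        (\<Sum>n. norm (c' n)) = C * (\<Sum>n. norm (c n)))"
      using fin by blast
  qed
qed

end

lemma block_norm_le:
  assumes "block_representation p q f c b"
  shows "block_norm p q f \<le> (\<Sum>n. norm (c n))"
  unfolding block_norm_def
proof (rule cInf_lower)
  show "bdd_below {(\<Sum>n. norm (c n)) |c b. block_representation p q f c b}"
    by (rule bdd_belowI[of _ 0]) (auto simp: block_representation_def intro: suminf_nonneg)
qed (use assms in blast)

theorem theorem3p7:
  fixes p q r :: real and v :: "'a::euclidean_space \<Rightarrow> real"
  assumes "1 < p" and "1 < q" and "q \<le> p" and "1 \<le> r" and "r < q"
    and "weight v"
    and "(\<lambda>x. v x powr p) \<in> muckenhoupt (p * (1 / r - 1 / q) + 1)"
  shows "bounded_on_weighted_block_space p q v (maximal r)"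
proof -
  interpret block_weight p q r v by unfold_locales (fact assms)+
  obtain C where C: "0 < C"
    and rep: "\<And>f c b. block_representation p q (\<lambda>x. f x * of_real (v x)) c b \<Longrightarrow>
      (AE x in lebesgue. maximal r f x < top) \<and>
      (\<exists>c' b'. block_representation p q
          (\<lambda>x. complex_of_real (enn2real (maximal r f x)) * of_real (v x)) c' b' \<and>
        (\<Sum>n. norm (c' n)) = C * (\<Sum>n. norm (c n)))"
    by (rule maximal_block_representation) blast
  show ?thesis
    unfolding bounded_on_weighted_block_space_def
  proof (intro exI[of _ C] conjI ballI)
    show "0 \<le> C" using C by simp
    fix f assume f: "f \<in> weighted_block_space p q v"
    let ?g = "\<lambda>x. complex_of_real (enn2real (maximal r f x))"
    from f obtain c b where cb: "block_representation p q (\<lambda>x. f x * of_real (v x)) c b"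
      by (auto simp: weighted_block_space_def block_space_def)
    show "AE x in lebesgue. maximal r f x < \<infinity>" using rep[OF cb] by simp
    show "?g \<in> weighted_block_space p q v"
      using rep[OF cb] by (auto simp: weighted_block_space_def block_space_def)
    have "weighted_block_norm p q v ?g / C \<le> weighted_block_norm p q v f"
      unfolding weighted_block_norm_def[of p q v f] block_norm_def
    proof (rule cInf_greatest)
      show "{(\<Sum>n. norm (c n)) |c b. block_representation p q (\<lambda>x. f x * of_real (v x)) c b} \<noteq> {}"
        using cb by blast
      fix s assume "s \<in> {(\<Sum>n. norm (c n)) |c b. block_representation p q (\<lambda>x. f x * of_real (v x)) c b}"
      then obtain c b where s: "s = (\<Sum>n. norm (c n))"
        and cb: "block_representation p q (\<lambda>x. f x * of_real (v x)) c b" by blast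
      from rep[OF cb] obtain c' b' where
        "block_representation p q (\<lambda>x. ?g x * of_real (v x)) c' b'" "(\<Sum>n. norm (c' n)) = C * s"
        unfolding s by blast
      then have "weighted_block_norm p q v ?g \<le> C * s"
        unfolding weighted_block_norm_def using block_norm_le by metis
      then show "weighted_block_norm p q v ?g / C \<le> s" using C by (simp add: field_simps)
    qed
    then show "weighted_block_norm p q v ?g \<le> C * weighted_block_norm p q v f"
      using C by (simp add: field_simps)
  qed
qed

end
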